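(* Let $\mu_n$ ($n\in\mathbb{N}$) and $\mu$ be finite signed Borel measures on $\mathbb{R}$. Then $\mu_n$ converges loosely to $\mu$ if and only if $\mu_n$ converges to $\mu$ either basically or almost basically and $(\mu_n)_{n\in\mathbb{N}}$ is uniformly bounded in variation, i.e. $\sup_{n\in\mathbb{N}}|\mu_n|(\mathbb{R})<\infty$. (The equivalence holds with "basically" and it also holds with "almost basically".)
   Context: For a finite signed Borel measure $\mu$ on $\mathbb{R}$, $|\mu|$ denotes its total variation measure and $F^{(\mu)}(x)=\mu((-\infty,x])$ its distribution function. $\mu_n$ converges loosely to $\mu$ if $\int f\,d\mu_n\to\int f\,d\mu$ for all continuous $f:\mathbb{R}\to\mathbb{R}$ vanishing at infinity. Functions $f_n:\mathbb{R}\to\mathbb{R}$ converge basically to $f:\mathbb{R}\to\mathbb{R}$ if every subsequence $(f_{n_k})_{k}$ contains a further subsequence $(f_{n_{k_l}})_{l}$ and there is an at most countable set $S\subset\mathbb{R}$ (which may depend on the subsequence) such that $f_{n_{k_l}}(x_1)-f_{n_{k_l}}(x_2)\to f(x_1)-f(x_2)$ as $l\to\infty$ for all $x_1,x_2\in\mathbb{R}\setminus S$. Almost basic convergence is defined in the same way, with "at most countable set $S$" replaced by "set $S$ of Lebesgue measure zero". Finite signed measures $\mu_n$ converge basically (resp. almost basically) to $\mu$ if $F^{(\mu_n)}$ converges basically (resp. almost basically) to $F^{(\mu)}$. *)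

theory Defs
  imports "HOL-Analysis.Analysis"
begin

text \<open>
  The library has no signed measures. A finite signed measure on the measurable space of \<open>M\<close>
  (only \<open>space M\<close> and \<open>sets M\<close> are used) is a real-valued set function; its values outside
  \<open>sets M\<close> are irrelevant.
\<close>

definition finite_signed_measure :: "'a measure \<Rightarrow> ('a set \<Rightarrow> real) \<Rightarrow> bool" where
  "finite_signed_measure M \<mu> \<longleftrightarrow>
     \<mu> {} = 0 \<and>
     (\<forall>A :: nat \<Rightarrow> 'a set. range A \<subseteq> sets M \<longrightarrow> disjoint_family A \<longrightarrow>
        (\<lambda>i. \<mu> (A i)) sums \<mu> (\<Union>i. A i))"

definition total_variation :: "'a measure \<Rightarrow> ('a set \<Rightarrow> real) \<Rightarrow> 'a set \<Rightarrow> ennreal" where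
  "total_variation M \<mu> A =
     (SUP P \<in> {P. finite P \<and> P \<subseteq> sets M \<and> disjoint P \<and> \<Union>P = A}. \<Sum>E\<in>P. ennreal \<bar>\<mu> E\<bar>)"

text \<open>
  The Jordan parts \<open>\<mu>\<^sup>+(A) = sup {\<mu> B | B \<subseteq> A}\<close> and \<open>\<mu>\<^sup>- = (- \<mu>)\<^sup>+\<close>. Truncation of negative values
  by \<open>ennreal\<close> does not affect the supremum, because \<open>B = {}\<close> contributes \<open>0\<close>.
\<close>

definition jordan_pos :: "'a measure \<Rightarrow> ('a set \<Rightarrow> real) \<Rightarrow> 'a measure" where
  "jordan_pos M \<mu> =
     measure_of (space M) (sets M) (\<lambda>A. SUP B \<in> {B \<in> sets M. B \<subseteq> A}. ennreal (\<mu> B))"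

definition jordan_neg :: "'a measure \<Rightarrow> ('a set \<Rightarrow> real) \<Rightarrow> 'a measure" where
  "jordan_neg M \<mu> = jordan_pos M (\<lambda>A. - \<mu> A)"

definition signed_integral :: "'a measure \<Rightarrow> ('a set \<Rightarrow> real) \<Rightarrow> ('a \<Rightarrow> real) \<Rightarrow> real" where
  "signed_integral M \<mu> f = (\<integral>x. f x \<partial>jordan_pos M \<mu>) - (\<integral>x. f x \<partial>jordan_neg M \<mu>)"

definition distribution_function :: "(real set \<Rightarrow> real) \<Rightarrow> real \<Rightarrow> real" where
  "distribution_function \<mu> x = \<mu> {..x}"

definition converges_loosely :: "(nat \<Rightarrow> real set \<Rightarrow> real) \<Rightarrow> (real set \<Rightarrow> real) \<Rightarrow> bool" where
  "converges_loosely \<mu>s \<mu> \<longleftrightarrow>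
     (\<forall>f :: real \<Rightarrow> real. continuous_on UNIV f \<longrightarrow> (f \<longlongrightarrow> 0) at_infinity \<longrightarrow>
        (\<lambda>n. signed_integral borel (\<mu>s n) f) \<longlonglongrightarrow> signed_integral borel \<mu> f)"

definition fun_converges_basically :: "(nat \<Rightarrow> real \<Rightarrow> real) \<Rightarrow> (real \<Rightarrow> real) \<Rightarrow> bool" where
  "fun_converges_basically fs f \<longleftrightarrow>
     (\<forall>r :: nat \<Rightarrow> nat. strict_mono r \<longrightarrow>
        (\<exists>(s :: nat \<Rightarrow> nat) S. strict_mono s \<and> countable S \<and>
           (\<forall>x1 \<in> - S. \<forall>x2 \<in> - S.
              (\<lambda>l. fs (r (s l)) x1 - fs (r (s l)) x2) \<longlonglongrightarrow> f x1 - f x2)))"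

definition fun_converges_almost_basically :: "(nat \<Rightarrow> real \<Rightarrow> real) \<Rightarrow> (real \<Rightarrow> real) \<Rightarrow> bool" where
  "fun_converges_almost_basically fs f \<longleftrightarrow>
     (\<forall>r :: nat \<Rightarrow> nat. strict_mono r \<longrightarrow>
        (\<exists>(s :: nat \<Rightarrow> nat) S. strict_mono s \<and> S \<in> null_sets lebesgue \<and>
           (\<forall>x1 \<in> - S. \<forall>x2 \<in> - S.
              (\<lambda>l. fs (r (s l)) x1 - fs (r (s l)) x2) \<longlonglongrightarrow> f x1 - f x2)))"

definition converges_basically :: "(nat \<Rightarrow> real set \<Rightarrow> real) \<Rightarrow> (real set \<Rightarrow> real) \<Rightarrow> bool" where
  "converges_basically \<mu>s \<mu> \<longleftrightarrow>
     fun_converges_basically (\<lambda>n. distribution_function (\<mu>s n)) (distribution_function \<mu>)"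

definition converges_almost_basically :: "(nat \<Rightarrow> real set \<Rightarrow> real) \<Rightarrow> (real set \<Rightarrow> real) \<Rightarrow> bool" where
  "converges_almost_basically \<mu>s \<mu> \<longleftrightarrow>
     fun_converges_almost_basically (\<lambda>n. distribution_function (\<mu>s n)) (distribution_function \<mu>)"

definition uniformly_bounded_in_variation :: "(nat \<Rightarrow> real set \<Rightarrow> real) \<Rightarrow> bool" where
  "uniformly_bounded_in_variation \<mu>s \<longleftrightarrow> (SUP n. total_variation borel (\<mu>s n) UNIV) < \<infinity>"

end

theory Submission
  imports Defs "HOL-Probability.Helly_Selection"
begin

text \<open>
  If the integrals converge for every continuous function vanishing at infinity, a gliding hump
  argument bounds the variations, since the variation of a signed measure is the norm of its
  integral functional. Helly's selection theorem, applied to the positive and negative Jordan parts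
  separately, then makes every subsequence have a further subsequence whose distribution functions
  have convergent increments off a countable set; the limiting increments are those of \<open>\<mu>\<close>, because
  a difference of two finite measures is determined on half-open intervals by the integrals of
  trapezoidal functions. Conversely, a continuous function vanishing at infinity is a uniform limit
  of step functions with jumps in any prescribed dense set, in particular in the complement of a
  null set, and bounded variation controls the error of this approximation.
\<close>

subsection \<open>Jordan decomposition of finite signed measures\<close>

text \<open>\<open>ennreal\<close> truncates negative reals to \<open>0\<close>, so on sums of mixed
  sign it is only subadditive.\<close>

lemma ennreal_sum_le: "ennreal (\<Sum>i\<in>I. f i) \<le> (\<Sum>i\<in>I. ennreal (f i))"
proof (induction I rule: infinite_finite_induct)
  case (insert x I)
  have "ennreal (a + b) \<le> ennreal a + ennreal b" for a b :: real
    by (cases "a \<ge> 0"; cases "b \<ge> 0")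
       (auto simp: ennreal_neg intro!: ennreal_leI simp flip: ennreal_plus)
  from order_trans[OF this add_left_mono[OF insert.IH]] show ?case
    using insert.hyps by simp
qed auto

lemma ennreal_le_suminf:
  assumes "f sums x"
  shows "ennreal x \<le> (\<Sum>i. ennreal (f i))"
proof (rule LIMSEQ_le_const2)
  show "(\<lambda>n. ennreal (\<Sum>i<n. f i)) \<longlonglongrightarrow> ennreal x"
    using assms by (intro tendsto_ennrealI) (simp add: sums_def)
  show "\<exists>N. \<forall>n\<ge>N. ennreal (\<Sum>i<n. f i) \<le> (\<Sum>i. ennreal (f i))"
    by (metis ennreal_sum_le order_trans sum_le_suminf summableI finite_lessThan zero_le)
qed

lemma finite_signed_measure_uminus:
  "finite_signed_measure M \<mu> \<Longrightarrow> finite_signed_measure M (\<lambda>A. - \<mu> A)"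
  by (auto simp: finite_signed_measure_def intro: sums_minus)

locale signed_measure =
  fixes M :: "'a measure" and \<mu> :: "'a set \<Rightarrow> real"
  assumes finite_signed: "finite_signed_measure M \<mu>"
begin

lemma empty [simp]: "\<mu> {} = 0"
  using finite_signed by (simp add: finite_signed_measure_def)

lemma UN_sums: "range A \<subseteq> sets M \<Longrightarrow> disjoint_family A \<Longrightarrow> (\<lambda>i. \<mu> (A i)) sums \<mu> (\<Union>i. A i)"
  using finite_signed by (simp add: finite_signed_measure_def)

lemma Un:
  assumes "A \<in> sets M" "B \<in> sets M" "A \<inter> B = {}"
  shows "\<mu> (A \<union> B) = \<mu> A + \<mu> B"
proof -
  have "(\<lambda>i. \<mu> (binaryset A B i)) sums \<mu> (\<Union>i. binaryset A B i)"
    using assms by (intro UN_sums) (auto simp: range_binaryset_eq disjoint_family_on_def binaryset_def)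
  moreover have "(\<lambda>i. \<mu> (binaryset A B i)) sums (\<mu> A + \<mu> B)"
    by (rule binaryset_sums) simp
  ultimately show ?thesis
    by (simp add: UN_binaryset_eq sums_unique2)
qed

lemma Diff: "A \<in> sets M \<Longrightarrow> B \<in> sets M \<Longrightarrow> B \<subseteq> A \<Longrightarrow> \<mu> (A - B) = \<mu> A - \<mu> B"
  using Un[of B "A - B"] by (simp add: Un_absorb1)

text \<open>The set function inside \<open>jordan_pos\<close>. It is studied on its own because
  \<open>measure_of\<close> takes its prescribed values only once countable additivity is
  known.\<close>

definition upper_variation :: "'a set \<Rightarrow> ennreal" where
  "upper_variation A = (SUP B \<in> {B \<in> sets M. B \<subseteq> A}. ennreal (\<mu> B))"

lemma upper_variation_upper: "B \<in> sets M \<Longrightarrow> B \<subseteq> A \<Longrightarrow> ennreal (\<mu> B) \<le> upper_variation A"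
  unfolding upper_variation_def by (rule SUP_upper) auto

text \<open>Competitors for \<open>A\<close> and for \<open>B\<close> have a union that competes for
  \<open>A \<union> B\<close>. A competitor of negative mass contributes \<open>0\<close> by
  truncation, and the other one then competes alone.\<close>

lemma upper_variation_Un_ge:
  assumes "A \<inter> B = {}"
  shows "upper_variation A + upper_variation B \<le> upper_variation (A \<union> B)"
proof -
  have *: "ennreal (\<mu> A') + ennreal (\<mu> B') \<le> upper_variation (A \<union> B)"
    if "A' \<in> sets M" "A' \<subseteq> A" "B' \<in> sets M" "B' \<subseteq> B" for A' B'
  proof (cases "\<mu> A' \<ge> 0 \<and> \<mu> B' \<ge> 0")
    case True
    then have "ennreal (\<mu> A') + ennreal (\<mu> B') = ennreal (\<mu> (A' \<union> B'))"
      using that assms by (subst Un) auto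
    also have "\<dots> \<le> upper_variation (A \<union> B)"
      using that by (intro upper_variation_upper) auto
    finally show ?thesis .
  next
    case False
    then show ?thesis
      using upper_variation_upper[of A' "A \<union> B", OF _ le_supI1] upper_variation_upper[of B' "A \<union> B", OF _ le_supI2] that
      by (auto simp: ennreal_neg not_le)
  qed
  have ne: "{B' \<in> sets M. B' \<subseteq> A} \<noteq> {}" for A
    by auto
  show ?thesis
    unfolding upper_variation_def[of A] ennreal_SUP_add_left[OF ne, symmetric]
    unfolding upper_variation_def[of B] ennreal_SUP_add_right[OF ne]
    by (intro SUP_least) (auto intro: *)
qed

text \<open>Every competitor \<open>B\<close> for the union splits into the pieces
  \<open>B \<inter> A i\<close>, each a competitor for its own \<open>A i\<close>; truncating their
  masses at \<open>0\<close> can only increase the sum.\<close>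

lemma upper_variation_UN_le:
  assumes A: "range A \<subseteq> sets M" "disjoint_family A"
  shows "upper_variation (\<Union>i. A i) \<le> (\<Sum>i. upper_variation (A i))"
  unfolding upper_variation_def[of "\<Union>i. A i"]
proof (rule SUP_least)
  fix B assume "B \<in> {B \<in> sets M. B \<subseteq> (\<Union>i. A i)}"
  then have B: "B \<in> sets M" "B = (\<Union>i. B \<inter> A i)"
    by auto
  have "(\<lambda>i. \<mu> (B \<inter> A i)) sums \<mu> (\<Union>i. B \<inter> A i)"
    using A B(1) by (intro UN_sums) (auto simp: disjoint_family_on_def)
  then have "ennreal (\<mu> B) \<le> (\<Sum>i. ennreal (\<mu> (B \<inter> A i)))"
    using B(2) ennreal_le_suminf by metis
  also have "\<dots> \<le> (\<Sum>i. upper_variation (A i))"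
    using A B(1) by (intro suminf_le upper_variation_upper summableI) auto
  finally show "ennreal (\<mu> B) \<le> (\<Sum>i. upper_variation (A i))" .
qed

lemma upper_variation_empty: "upper_variation {} = 0"
proof -
  have "{B \<in> sets M. B \<subseteq> {}} = {{}}"
    by auto
  then show ?thesis
    by (simp add: upper_variation_def)
qed

lemma upper_variation_mono: "A \<subseteq> B \<Longrightarrow> upper_variation A \<le> upper_variation B"
  unfolding upper_variation_def by (rule SUP_subset_mono) auto

text \<open>Superadditivity on disjoint pairs, iterated and combined with monotonicity, bounds every
  partial sum; countable subadditivity is the other inequality.\<close>

lemma countably_additive_upper_variation: "countably_additive (sets M) upper_variation"
proof (rule countably_additiveI)
  fix A :: "nat \<Rightarrow> 'a set"
  assume A: "range A \<subseteq> sets M" "disjoint_family A"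
  show "(\<Sum>i. upper_variation (A i)) = upper_variation (\<Union>i. A i)"
  proof (rule antisym)
    have "(\<Sum>i<n. upper_variation (A i)) \<le> upper_variation (\<Union>i<n. A i)" for n
    proof (induction n)
      case (Suc n)
      have "(\<Sum>i<Suc n. upper_variation (A i)) \<le> upper_variation (\<Union>i<n. A i) + upper_variation (A n)"
        using Suc by (simp add: add_right_mono)
      also have "\<dots> \<le> upper_variation ((\<Union>i<n. A i) \<union> A n)"
      proof (rule upper_variation_Un_ge)
        have "A i \<inter> A n = {}" if "i < n" for i
          using A(2) that by (intro disjoint_family_onD[of A UNIV]) auto
        then show "(\<Union>i<n. A i) \<inter> A n = {}"
          by auto
      qed
      also have "(\<Union>i<n. A i) \<union> A n = (\<Union>i<Suc n. A i)"
        by (auto simp: lessThan_Suc)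
      finally show ?case .
    qed (simp add: upper_variation_empty)
    then have "(\<Sum>i<n. upper_variation (A i)) \<le> upper_variation (\<Union>i. A i)" for n
      by (rule order_trans) (auto intro!: upper_variation_mono)
    then show "(\<Sum>i. upper_variation (A i)) \<le> upper_variation (\<Union>i. A i)"
      by (intro suminf_le_const summableI) auto
  qed (rule upper_variation_UN_le[OF A])
qed

lemma sets_jordan_pos [simp, measurable_cong]: "sets (jordan_pos M \<mu>) = sets M"
  by (simp add: jordan_pos_def)

lemma space_jordan_pos [simp]: "space (jordan_pos M \<mu>) = space M"
  by (simp add: jordan_pos_def)

lemma emeasure_jordan_pos: "A \<in> sets M \<Longrightarrow> emeasure (jordan_pos M \<mu>) A = upper_variation A"
  by (rule emeasure_measure_of[where \<Omega> = "space M" and A = "sets M"])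
     (auto simp: jordan_pos_def upper_variation_def[abs_def] positive_def upper_variation_empty[unfolded upper_variation_def]
        countably_additive_upper_variation[unfolded upper_variation_def[abs_def]] sets.sets_into_space dest: sets.sets_into_space)

text \<open>
  If \<open>A\<close> has infinite upper variation, one of the two pieces of a suitable splitting of \<open>A\<close>
  again has infinite upper variation while the other one carries mass at least \<open>1\<close>; iterating this
  gives disjoint sets whose masses do not tend to \<open>0\<close>.
\<close>

lemma upper_variation_splitting:
  assumes "A \<in> sets M" "upper_variation A = \<infinity>"
  shows "\<exists>A' \<in> sets M. A' \<subseteq> A \<and> upper_variation A' = \<infinity> \<and> 1 \<le> \<bar>\<mu> (A - A')\<bar>"
proof -
  \<comment> \<open>The margin \<open>\<bar>\<mu> A\<bar> + 1\<close> makes both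
    \<open>\<mu> B\<close> and \<open>\<bar>\<mu> A - \<mu> B\<bar>\<close> at least
    \<open>1\<close>, so it does not matter which of \<open>B\<close> and \<open>A - B\<close>
    inherits the infinite upper variation.\<close>
  have "ennreal (\<bar>\<mu> A\<bar> + 1) < upper_variation A"
    using assms by simp
  then obtain B where B: "B \<in> sets M" "B \<subseteq> A" "ennreal (\<bar>\<mu> A\<bar> + 1) < ennreal (\<mu> B)"
    unfolding upper_variation_def less_SUP_iff by auto
  then have muB: "\<bar>\<mu> A\<bar> + 1 < \<mu> B"
    by (simp add: ennreal_less_iff del: ennreal_plus)
  have diff: "\<mu> (A - B) = \<mu> A - \<mu> B"
    using assms B by (intro Diff)
  have "upper_variation A \<le> (\<Sum>i. upper_variation (binaryset B (A - B) i))"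
  proof -
    have "(\<Union>i. binaryset B (A - B) i) = A"
      using B(2) by (auto simp: UN_binaryset_eq)
    moreover have "disjoint_family (binaryset B (A - B))"
      by (auto simp: disjoint_family_on_def binaryset_def)
    ultimately show ?thesis
      using upper_variation_UN_le[of "binaryset B (A - B)"] assms(1) B(1)
      by (simp add: range_binaryset_eq)
  qed
  also have "\<dots> = upper_variation B + upper_variation (A - B)"
    using binaryset_sums[of upper_variation B "A - B"] by (simp add: upper_variation_empty sums_iff)
  finally consider "upper_variation B = \<infinity>" | "upper_variation (A - B) = \<infinity>"
    using assms(2) by (auto simp: top_unique)
  then show ?thesis
  proof cases
    case 1
    then show ?thesis
      using B muB diff by (intro bexI[of _ B]) auto
  next
    case 2
    moreover have "A - (A - B) = B"
      using B by auto
    ultimately show ?thesis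
      using B muB assms(1) by (intro bexI[of _ "A - B"]) auto
  qed
qed

lemma upper_variation_space_finite: "upper_variation (space M) \<noteq> \<infinity>"
proof
  assume inf: "upper_variation (space M) = \<infinity>"
  obtain A where A: "\<And>n. A n \<in> sets M \<and> upper_variation (A n) = \<infinity>"
      "\<And>n. A (Suc n) \<subseteq> A n \<and> 1 \<le> \<bar>\<mu> (A n - A (Suc n))\<bar>"
    using dependent_nat_choice[of "\<lambda>_ A. A \<in> sets M \<and> upper_variation A = \<infinity>"
        "\<lambda>_ A A'. A' \<subseteq> A \<and> 1 \<le> \<bar>\<mu> (A - A')\<bar>"] inf upper_variation_splitting
    by (metis sets.top)
  have dec: "A n \<subseteq> A m" if "m \<le> n" for m n
    using lift_Suc_antimono_le[of A m n] A(2) that by auto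
  have "disjoint_family (\<lambda>n. A n - A (Suc n))"
    unfolding disjoint_family_on_def
  proof (intro ballI impI)
    fix m n :: nat assume "m \<noteq> n"
    then consider "Suc m \<le> n" | "Suc n \<le> m"
      by linarith
    then show "(A m - A (Suc m)) \<inter> (A n - A (Suc n)) = {}"
      using dec[of "Suc m" n] dec[of "Suc n" m] by cases auto
  qed
  \<comment> \<open>Countable additivity with real values makes this series converge, so its terms
    tend to \<open>0\<close>, although each has absolute value at least \<open>1\<close>.\<close>
  then have "(\<lambda>n. \<mu> (A n - A (Suc n))) sums \<mu> (\<Union>n. A n - A (Suc n))"
    using A(1) by (intro UN_sums) auto
  then have "(\<lambda>n. \<mu> (A n - A (Suc n))) \<longlonglongrightarrow> 0"
    by (intro summable_LIMSEQ_zero) (rule sums_summable)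
  then have "\<forall>\<^sub>F n in sequentially. \<bar>\<mu> (A n - A (Suc n))\<bar> < 1"
    by (auto simp: tendsto_iff dist_real_def)
  then show False
    using A(2) by (auto simp: eventually_sequentially not_less[symmetric])
qed

sublocale pos: finite_measure "jordan_pos M \<mu>"
  using upper_variation_space_finite by (intro finite_measureI) (simp add: emeasure_jordan_pos)

lemma measure_jordan_pos_upper:
  assumes "A \<in> sets M" "B \<in> sets M" "B \<subseteq> A"
  shows "\<mu> B \<le> measure (jordan_pos M \<mu>) A"
  using upper_variation_upper[OF assms(2,3)] assms(1)
  by (simp add: pos.emeasure_eq_measure flip: emeasure_jordan_pos)

lemma measure_jordan_pos_least:
  assumes "A \<in> sets M" and le: "\<And>B. B \<in> sets M \<Longrightarrow> B \<subseteq> A \<Longrightarrow> \<mu> B \<le> c"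
  shows "measure (jordan_pos M \<mu>) A \<le> c"
proof -
  have "upper_variation A \<le> ennreal c"
    unfolding upper_variation_def using le by (intro SUP_least ennreal_leI) auto
  \<comment> \<open>The empty competitor yields this bound, which ensures that
    \<open>ennreal c\<close> does not truncate \<open>c\<close>.\<close>
  moreover have "0 \<le> c"
    using le[of "{}"] by simp
  ultimately show ?thesis
    using assms(1) by (simp add: pos.emeasure_eq_measure flip: emeasure_jordan_pos)
qed


lemma sets_jordan_neg [simp, measurable_cong]: "sets (jordan_neg M \<mu>) = sets M"
  by (simp add: jordan_neg_def jordan_pos_def)

lemma space_jordan_neg [simp]: "space (jordan_neg M \<mu>) = space M"
  by (simp add: jordan_neg_def jordan_pos_def)

end

sublocale signed_measure \<subseteq> neg: finite_measure "jordan_neg M \<mu>"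
proof -
  interpret uminus: signed_measure M "\<lambda>A. - \<mu> A"
    by unfold_locales (rule finite_signed_measure_uminus[OF finite_signed])
  show "finite_measure (jordan_neg M \<mu>)"
    unfolding jordan_neg_def by (rule uminus.pos.finite_measure_axioms)
qed

context signed_measure
begin

text \<open>For \<open>B \<subseteq> A\<close>, \<open>\<mu> B = \<mu> A - \<mu> (A - B)\<close>,
  and \<open>- \<mu> (A - B)\<close> is at most the negative part of \<open>A\<close>. The supremum
  over \<open>B\<close> gives one inequality; the same argument for \<open>- \<mu>\<close> gives the
  other.\<close>

lemma jordan_decomposition:
  assumes A: "A \<in> sets M"
  shows "\<mu> A = measure (jordan_pos M \<mu>) A - measure (jordan_neg M \<mu>) A"
proof -
  interpret uminus: signed_measure M "\<lambda>A. - \<mu> A"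
    by unfold_locales (rule finite_signed_measure_uminus[OF finite_signed])
  have "measure (jordan_pos M \<mu>) A \<le> \<mu> A + measure (jordan_neg M \<mu>) A"
  proof (rule measure_jordan_pos_least[OF A])
    fix B assume B: "B \<in> sets M" "B \<subseteq> A"
    then show "\<mu> B \<le> \<mu> A + measure (jordan_neg M \<mu>) A"
      using uminus.measure_jordan_pos_upper[OF A, of "A - B"] Diff[OF A, of B] A
      by (auto simp: jordan_neg_def)
  qed
  moreover have "measure (jordan_neg M \<mu>) A \<le> measure (jordan_pos M \<mu>) A - \<mu> A"
    unfolding jordan_neg_def
  proof (rule uminus.measure_jordan_pos_least[OF A])
    fix B assume B: "B \<in> sets M" "B \<subseteq> A"
    then show "- \<mu> B \<le> measure (jordan_pos M \<mu>) A - \<mu> A"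
      using measure_jordan_pos_upper[OF A, of "A - B"] Diff[OF A, of B] A
      by auto
  qed
  ultimately show ?thesis
    by simp
qed

section \<open>Total variation as the sum of the masses of the Jordan parts\<close>

abbreviation variation :: real where
  "variation \<equiv> measure (jordan_pos M \<mu>) (space M) + measure (jordan_neg M \<mu>) (space M)"

text \<open>An approximate Hahn set: \<open>B\<close> almost attains the supremum that defines the
  positive part of the whole space. By the Jordan decomposition, \<open>\<mu> B\<close> falls short
  of that supremum by exactly the quantity bounded here.\<close>

lemma approx_Hahn:
  assumes "0 < \<epsilon>"
  obtains B where "B \<in> sets M"
    "measure (jordan_pos M \<mu>) (space M - B) + measure (jordan_neg M \<mu>) B < \<epsilon>"
proof -
  obtain B where B: "B \<in> sets M" "\<mu> B > measure (jordan_pos M \<mu>) (space M) - \<epsilon>"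
  proof (rule ccontr)
    assume "\<not> thesis"
    then have "measure (jordan_pos M \<mu>) (space M) \<le> measure (jordan_pos M \<mu>) (space M) - \<epsilon>"
      using that by (intro measure_jordan_pos_least) (auto simp: not_less[symmetric])
    with assms show False by simp
  qed
  show thesis
    using that[OF B(1)] B pos.finite_measure_compl[of B] jordan_decomposition[of B] by auto
qed

lemma sum_abs_le_variation:
  assumes P: "finite P" "P \<subseteq> sets M" "disjoint P" "\<Union>P = space M"
  shows "(\<Sum>E\<in>P. \<bar>\<mu> E\<bar>) \<le> variation"
proof -
  have "(\<Sum>E\<in>P. \<bar>\<mu> E\<bar>) \<le>
      (\<Sum>E\<in>P. measure (jordan_pos M \<mu>) E + measure (jordan_neg M \<mu>) E)"
  proof (rule sum_mono)
    fix E assume "E \<in> P"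
    then have "\<mu> E = measure (jordan_pos M \<mu>) E - measure (jordan_neg M \<mu>) E"
      using P(2) by (intro jordan_decomposition) auto
    then show "\<bar>\<mu> E\<bar> \<le> measure (jordan_pos M \<mu>) E + measure (jordan_neg M \<mu>) E"
      using measure_nonneg[of "jordan_pos M \<mu>" E] measure_nonneg[of "jordan_neg M \<mu>" E]
      by linarith
  qed
  moreover have "(\<Sum>E\<in>P. measure (jordan_pos M \<mu>) E) = measure (jordan_pos M \<mu>) (\<Union>E\<in>P. E)"
    using P(1-3) by (intro pos.finite_measure_finite_Union[symmetric])
      (auto simp: disjoint_def disjoint_family_on_def)
  moreover have "(\<Sum>E\<in>P. measure (jordan_neg M \<mu>) E) = measure (jordan_neg M \<mu>) (\<Union>E\<in>P. E)"
    using P(1-3) by (intro neg.finite_measure_finite_Union[symmetric])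
      (auto simp: disjoint_def disjoint_family_on_def)
  ultimately show ?thesis
    using P(4) by (simp add: sum.distrib)
qed

text \<open>For an approximate Hahn set \<open>B\<close>,
  \<open>\<mu> B - \<mu> (space M - B)\<close> falls short of \<open>variation\<close> by twice the
  defect of \<open>B\<close>; hence the choice of \<open>\<epsilon> / 2\<close> in the
  proof.\<close>

lemma variation_le_sum_abs:
  assumes "0 < \<epsilon>"
  obtains B where "B \<in> sets M" "variation \<le> \<bar>\<mu> B\<bar> + \<bar>\<mu> (space M - B)\<bar> + \<epsilon>"
proof -
  obtain B where B: "B \<in> sets M"
      "measure (jordan_pos M \<mu>) (space M - B) + measure (jordan_neg M \<mu>) B < \<epsilon> / 2"
    using approx_Hahn[of "\<epsilon> / 2"] assms by (metis half_gt_zero)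
  have "measure (jordan_pos M \<mu>) (space M - B) = measure (jordan_pos M \<mu>) (space M) - measure (jordan_pos M \<mu>) B"
    "measure (jordan_neg M \<mu>) (space M - B) = measure (jordan_neg M \<mu>) (space M) - measure (jordan_neg M \<mu>) B"
    using pos.finite_measure_compl[of B] neg.finite_measure_compl[of B] B(1) by simp_all
  moreover have "\<mu> B = measure (jordan_pos M \<mu>) B - measure (jordan_neg M \<mu>) B"
    using B(1) by (rule jordan_decomposition)
  moreover have "\<mu> (space M - B) =
      measure (jordan_pos M \<mu>) (space M - B) - measure (jordan_neg M \<mu>) (space M - B)"
    using B(1) by (intro jordan_decomposition) auto
  ultimately have "variation \<le> \<bar>\<mu> B\<bar> + \<bar>\<mu> (space M - B)\<bar> + \<epsilon>"
    using B(2) abs_ge_self[of "\<mu> B"] abs_ge_minus_self[of "\<mu> (space M - B)"] by linarith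
  with B(1) show thesis
    by (rule that)
qed

lemma sum_abs_le_total_variation:
  assumes "B \<in> sets M"
  shows "ennreal \<bar>\<mu> B\<bar> + ennreal \<bar>\<mu> (space M - B)\<bar> \<le> total_variation M \<mu> (space M)"
proof -
  have "ennreal \<bar>\<mu> B\<bar> + ennreal \<bar>\<mu> (space M - B)\<bar> = (\<Sum>E\<in>{B, space M - B}. ennreal \<bar>\<mu> E\<bar>)"
  \<comment> \<open>If the two pieces coincide, the set of pieces has only one element; the space is
    then empty and both sides vanish.\<close>
  proof (cases "B = space M - B")
    case True
    then have "B = {}" "space M = {}"
      by blast+
    then show ?thesis
      by simp
  qed simp
  also have "\<dots> \<le> total_variation M \<mu> (space M)"
    unfolding total_variation_def using assms sets.sets_into_space[of B M]
    by (intro SUP_upper) (auto simp: disjoint_def)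
  finally show ?thesis .
qed

lemma total_variation_space: "total_variation M \<mu> (space M) = ennreal variation"
proof (rule antisym)
  show "total_variation M \<mu> (space M) \<le> ennreal variation"
    unfolding total_variation_def
    by (rule SUP_least) (simp add: sum_abs_le_variation ennreal_leI del: ennreal_plus)
  show "ennreal variation \<le> total_variation M \<mu> (space M)"
  proof (rule ennreal_le_epsilon)
    fix \<epsilon> :: real assume "0 < \<epsilon>"
    then obtain B where B: "B \<in> sets M" "variation \<le> \<bar>\<mu> B\<bar> + \<bar>\<mu> (space M - B)\<bar> + \<epsilon>"
      by (rule variation_le_sum_abs)
    have "ennreal variation \<le> ennreal (\<bar>\<mu> B\<bar> + \<bar>\<mu> (space M - B)\<bar> + \<epsilon>)"
      using B(2) by (rule ennreal_leI)
    also have "\<dots> = (ennreal \<bar>\<mu> B\<bar> + ennreal \<bar>\<mu> (space M - B)\<bar>) + ennreal \<epsilon>"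
      using \<open>0 < \<epsilon>\<close> by simp
    also have "\<dots> \<le> total_variation M \<mu> (space M) + ennreal \<epsilon>"
      by (intro add_right_mono sum_abs_le_total_variation B(1))
    finally show "ennreal variation \<le> total_variation M \<mu> (space M) + ennreal \<epsilon>" .
  qed
qed

end

subsection \<open>Continuous functions vanishing at infinity\<close>

definition vanishing :: "(real \<Rightarrow> real) \<Rightarrow> bool" where
  "vanishing f \<longleftrightarrow> continuous_on UNIV f \<and> (f \<longlongrightarrow> 0) at_infinity"

lemma vanishing_borel: "vanishing f \<Longrightarrow> f \<in> borel_measurable borel"
  by (simp add: vanishing_def borel_measurable_continuous_onI)

lemma vanishing_small_outside:
  assumes "vanishing f" "0 < \<epsilon>"
  obtains R where "0 < R" "\<And>x. R \<le> \<bar>x\<bar> \<Longrightarrow> \<bar>f x\<bar> < \<epsilon>"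
proof -
  have "\<forall>\<^sub>F x in at_infinity. \<bar>f x\<bar> < \<epsilon>"
    using assms by (auto simp: vanishing_def tendsto_iff dist_real_def)
  then obtain b where "\<And>x. b \<le> \<bar>x\<bar> \<Longrightarrow> \<bar>f x\<bar> < \<epsilon>"
    by (auto simp: eventually_at_infinity)
  then show thesis
    by (intro that[of "max b 1"]) auto
qed

lemma vanishing_bounded:
  assumes "vanishing f"
  obtains c where "\<And>x. \<bar>f x\<bar> \<le> c"
proof -
  obtain R where R: "0 < R" "\<And>x. R \<le> \<bar>x\<bar> \<Longrightarrow> \<bar>f x\<bar> < 1"
    using vanishing_small_outside[OF assms zero_less_one] by metis
  have "compact (f ` {-R..R})"
    using assms by (intro compact_continuous_image) (auto simp: vanishing_def intro: continuous_on_subset)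
  then obtain c where c: "\<And>x. x \<in> {-R..R} \<Longrightarrow> \<bar>f x\<bar> \<le> c"
    using compact_imp_bounded by (force simp: bounded_iff)
  have "\<bar>f x\<bar> \<le> max c 1" for x
  proof (cases "R \<le> \<bar>x\<bar>")
    case False
    then have "x \<in> {-R..R}"
      by auto
    with c[of x] show ?thesis by simp
  qed (use R(2)[of x] in simp)
  then show thesis
    by (rule that)
qed

lemma vanishing_compact_support:
  assumes "continuous_on UNIV f" "\<And>x. R \<le> \<bar>x\<bar> \<Longrightarrow> f x = 0"
  shows "vanishing f"
proof -
  have "\<forall>\<^sub>F x in at_infinity. f x = 0"
    using assms(2) by (auto simp: eventually_at_infinity)
  with assms(1) show ?thesis
    by (simp add: vanishing_def tendsto_eventually)
qed

lemma vanishing_zero: "vanishing (\<lambda>x. 0)"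
  by (simp add: vanishing_def)

lemma vanishing_add_mult:
  assumes "vanishing f" "vanishing g"
  shows "vanishing (\<lambda>x. f x + c * g x)"
  using assms unfolding vanishing_def
  by (auto intro!: continuous_intros tendsto_eq_intros)

text \<open>Needed for the gliding hump, whose test function is a uniform limit. Continuity passes
  to uniform limits, and the tail of \<open>g\<close> is controlled by that of a single close
  \<open>f n\<close>.\<close>

lemma vanishing_uniform_limit:
  assumes "\<And>n. vanishing (f n)" "uniform_limit UNIV f g sequentially"
  shows "vanishing g"
  unfolding vanishing_def
proof
  show "continuous_on UNIV g"
    using assms by (intro uniform_limit_theorem[OF _ assms(2)]) (auto simp: vanishing_def)
  show "(g \<longlongrightarrow> 0) at_infinity"
  proof (rule tendstoI)
    fix \<epsilon> :: real assume "0 < \<epsilon>"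
    then obtain n where "\<forall>x\<in>UNIV. dist (f n x) (g x) < \<epsilon> / 2"
      using eventually_happens'[OF sequentially_bot uniform_limitD[OF assms(2) half_gt_zero]] by metis
    then have n: "\<bar>f n x - g x\<bar> < \<epsilon> / 2" for x
      by (simp add: dist_real_def)
    have "\<forall>\<^sub>F x in at_infinity. \<bar>f n x\<bar> < \<epsilon> / 2"
      using tendstoD[OF _ half_gt_zero[OF \<open>0 < \<epsilon>\<close>], of "f n" 0 at_infinity] assms(1)[of n]
      by (simp add: vanishing_def dist_real_def)
    then show "\<forall>\<^sub>F x in at_infinity. dist (g x) 0 < \<epsilon>"
    proof eventually_elim
      case (elim x)
      with n[of x] show ?case unfolding dist_real_def by linarith
    qed
  qed
qed

lemma vanishing_uniformly_continuous:
  assumes "vanishing f" "0 < \<epsilon>"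
  obtains \<delta> where "0 < \<delta>" "\<And>x y. \<bar>x - y\<bar> < \<delta> \<Longrightarrow> \<bar>f x - f y\<bar> < \<epsilon>"
proof -
  obtain R where R: "0 < R" "\<And>x. R \<le> \<bar>x\<bar> \<Longrightarrow> \<bar>f x\<bar> < \<epsilon> / 2"
    using vanishing_small_outside[OF assms(1) half_gt_zero[OF assms(2)]] by metis
  have "uniformly_continuous_on {-(R + 1)..R + 1} f"
    using assms(1) by (intro compact_uniformly_continuous)
      (auto simp: vanishing_def intro: continuous_on_subset)
  then obtain \<delta> where \<delta>: "0 < \<delta>"
      "\<And>x y. x \<in> {-(R + 1)..R + 1} \<Longrightarrow> y \<in> {-(R + 1)..R + 1} \<Longrightarrow> \<bar>x - y\<bar> < \<delta> \<Longrightarrow> \<bar>f x - f y\<bar> < \<epsilon>"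
    using assms(2) by (force simp: uniformly_continuous_on_def dist_real_def)
  \<comment> \<open>Points at distance less than \<open>1\<close> either both lie in the enlarged
    interval or both lie beyond \<open>R\<close>, where the two values are below
    \<open>\<epsilon> / 2\<close>.\<close>
  have "\<bar>f x - f y\<bar> < \<epsilon>" if xy: "\<bar>x - y\<bar> < min \<delta> 1" for x y
  proof (cases "x \<in> {-(R + 1)..R + 1} \<and> y \<in> {-(R + 1)..R + 1}")
    case True
    with \<delta>(2) xy show ?thesis by auto
  next
    case False
    then have "R \<le> \<bar>x\<bar>" "R \<le> \<bar>y\<bar>"
      using xy by auto
    then show ?thesis
      using R(2)[of x] R(2)[of y] by linarith
  qed
  then show thesis
    using \<delta>(1) by (intro that[of "min \<delta> 1"]) auto
qed

lemma ex_grid_interval: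
  fixes x :: "nat \<Rightarrow> real"
  assumes "x 0 < t" "t \<le> x m"
  shows "\<exists>j<m. t \<in> {x j<..x (Suc j)}"
  using assms(2)
proof (induction m)
  case 0
  with assms(1) show ?case by simp
next
  case (Suc m)
  then show ?case
    by (cases "t \<le> x m") (auto intro: less_SucI)
qed

text \<open>Uniform continuity bounds the oscillation of \<open>f\<close> on short cells, and
  \<open>f\<close> is small outside a bounded interval, so steps taking the value at the right
  endpoint suffice. The cells are half-open so that their masses are increments of distribution
  functions.\<close>

lemma vanishing_step_approximation:
  fixes D :: "real set"
  assumes f: "vanishing f" and "0 < \<epsilon>"
    and dense: "\<And>a b. a < b \<Longrightarrow> \<exists>x\<in>D. a < x \<and> x < b"
  obtains x :: "nat \<Rightarrow> real" and m where "strict_mono x" "range x \<subseteq> D"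
    "\<And>t. \<bar>f t - (\<Sum>i<m. f (x (Suc i)) * indicator {x i<..x (Suc i)} t)\<bar> \<le> \<epsilon>"
proof -
  obtain R where R: "0 < R" "\<And>x. R \<le> \<bar>x\<bar> \<Longrightarrow> \<bar>f x\<bar> < \<epsilon>"
    using vanishing_small_outside[OF f \<open>0 < \<epsilon>\<close>] by metis
  obtain \<delta> where \<delta>: "0 < \<delta>" "\<And>x y. \<bar>x - y\<bar> < \<delta> \<Longrightarrow> \<bar>f x - f y\<bar> < \<epsilon>"
    using vanishing_uniformly_continuous[OF f \<open>0 < \<epsilon>\<close>] by metis
  \<comment> \<open>The auxiliary mesh is \<open>\<delta> / 2\<close> because points chosen from
    adjacent cells differ by less than two cell lengths. It starts one cell to the left of
    \<open>- R\<close>, which gives \<open>x 0 < - R\<close>.\<close>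
  define a where "a i = - R - \<delta> / 2 + real i * (\<delta> / 2)" for i :: nat
  have a_Suc: "a (Suc i) = a i + \<delta> / 2" for i
    by (simp add: a_def algebra_simps)
  have "\<forall>i. \<exists>x\<in>D. a i < x \<and> x < a (Suc i)"
    using dense a_Suc \<delta>(1) by simp
  then obtain x where x: "\<And>i. x i \<in> D" "\<And>i. a i < x i" "\<And>i. x i < a (Suc i)"
    by metis
  have mono: "strict_mono x"
    using x(2,3) by (intro strict_mono_Suc_iff[THEN iffD2]) (meson less_trans)
  have step: "x (Suc i) - x i < \<delta>" for i
    using x(2)[of i] x(3)[of "Suc i"] by (simp add: a_Suc)
  have x0: "x 0 < - R"
    using x(3)[of 0] by (simp add: a_def)
  obtain m where "(2 * R + \<delta> / 2) / (\<delta> / 2) < real m"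
    using reals_Archimedean2 by blast
  then have "R < a m"
    using \<delta>(1) by (simp add: a_def field_simps)
  then have xm: "R < x m"
    using x(2)[of m] by simp
  let ?s = "\<lambda>t. \<Sum>i<m. f (x (Suc i)) * indicator {x i<..x (Suc i)} t"
  have "\<bar>f t - ?s t\<bar> \<le> \<epsilon>" for t
  proof (cases "x 0 < t \<and> t \<le> x m")
    case True
    then obtain j where j: "j < m" "t \<in> {x j<..x (Suc j)}"
      using ex_grid_interval by blast
    have "t \<notin> {x i<..x (Suc i)}" if "i \<noteq> j" for i
    proof -
      consider "Suc i \<le> j" | "Suc j \<le> i"
        using \<open>i \<noteq> j\<close> by linarith
      then show ?thesis
        using strict_mono_less_eq[OF mono, of "Suc i" j] strict_mono_less_eq[OF mono, of "Suc j" i] j(2)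
        by cases auto
    qed
    then have "?s t = (\<Sum>i<m. if i = j then f (x (Suc j)) else 0)"
      using j(2) by (intro sum.cong) auto
    then have "?s t = f (x (Suc j))"
      using j(1) by simp
    moreover have "\<bar>t - x (Suc j)\<bar> < \<delta>"
      using j(2) step[of j] by auto
    ultimately show ?thesis
      using \<delta>(2)[of t "x (Suc j)"] by simp
  next
    case False
    have "t \<notin> {x i<..x (Suc i)}" if "i < m" for i
    proof -
      have "x 0 \<le> x i" "x (Suc i) \<le> x m"
        using strict_mono_less_eq[OF mono] that by auto
      with False show ?thesis
        by auto
    qed
    then have "?s t = 0"
      by (intro sum.neutral) auto
    moreover have "R \<le> \<bar>t\<bar>"
      using False x0 xm by auto
    ultimately show ?thesis
      using R(2)[of t] by simp
  qed
  then show thesis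
    using mono x(1) by (intro that) auto
qed

section \<open>Functionals given by the difference of two finite Borel measures\<close>

locale finite_borel_pair = P: finite_measure P + N: finite_measure N
  for P N :: "real measure" +
  assumes sets_P [simp, measurable_cong]: "sets P = sets borel"
    and sets_N [simp, measurable_cong]: "sets N = sets borel"
begin

lemma space_P [simp]: "space P = UNIV" and space_N [simp]: "space N = UNIV"
  using sets_eq_imp_space_eq[OF sets_P] sets_eq_imp_space_eq[OF sets_N] by simp_all

text \<open>The integral against \<open>P - N\<close>. The two measures may overlap: the limits
  obtained from Helly's theorem for positive and negative parts separately can share mass.\<close>

definition I :: "(real \<Rightarrow> real) \<Rightarrow> real" where
  "I f = (\<integral>x. f x \<partial>P) - (\<integral>x. f x \<partial>N)"

text \<open>A bound for the norm of \<open>I\<close>; it is the total variation when the pair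
  consists of the Jordan parts of a signed measure.\<close>

definition mass :: real where
  "mass = measure P UNIV + measure N UNIV"

lemma mass_nonneg: "0 \<le> mass"
  by (simp add: mass_def)

lemma integrable_bounded:
  fixes f :: "real \<Rightarrow> real"
  assumes "f \<in> borel_measurable borel" "\<And>x. \<bar>f x\<bar> \<le> c"
  shows "integrable P f" "integrable N f"
  using assms by (auto intro!: P.integrable_const_bound[where B = c] N.integrable_const_bound[where B = c])

lemma integrable_vanishing:
  assumes "vanishing f"
  shows "integrable P f" "integrable N f"
  using vanishing_bounded[OF assms] integrable_bounded[OF vanishing_borel[OF assms]] by metis+

lemma I_bound:
  assumes "f \<in> borel_measurable borel" "\<And>x. \<bar>f x\<bar> \<le> c"
  shows "\<bar>I f\<bar> \<le> mass * c"
proof -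
  have "\<bar>\<integral>x. f x \<partial>P\<bar> \<le> (\<integral>x. c \<partial>P)" "\<bar>\<integral>x. f x \<partial>N\<bar> \<le> (\<integral>x. c \<partial>N)"
    using Bochner_Integration.integral_norm_bound_integral[of P f "\<lambda>_. c"]
      Bochner_Integration.integral_norm_bound_integral[of N f "\<lambda>_. c"]
      integrable_bounded[OF assms] assms(2) by simp_all
  then show ?thesis
    by (simp add: I_def mass_def algebra_simps)
qed

lemma I_diff:
  "integrable P f \<Longrightarrow> integrable N f \<Longrightarrow> integrable P g \<Longrightarrow> integrable N g \<Longrightarrow>
    I (\<lambda>x. f x - g x) = I f - I g"
  by (simp add: I_def)

lemma I_add_mult:
  "integrable P f \<Longrightarrow> integrable N f \<Longrightarrow> integrable P g \<Longrightarrow> integrable N g \<Longrightarrow>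
    I (\<lambda>x. f x + c * g x) = I f + c * I g"
  by (simp add: I_def algebra_simps)

lemma I_step:
  "I (\<lambda>t. \<Sum>i<m. c i * indicator {x i<..y i} t) =
    (\<Sum>i<m. c i * (measure P {x i<..y i} - measure N {x i<..y i}))"
proof -
  have "(\<integral>t. (\<Sum>i<m. c i * indicator {x i<..y i} t) \<partial>P) = (\<Sum>i<m. c i * measure P {x i<..y i})"
    by (subst Bochner_Integration.integral_sum) (auto simp: P.emeasure_eq_measure)
  moreover have "(\<integral>t. (\<Sum>i<m. c i * indicator {x i<..y i} t) \<partial>N) = (\<Sum>i<m. c i * measure N {x i<..y i})"
    by (subst Bochner_Integration.integral_sum) (auto simp: N.emeasure_eq_measure)
  ultimately show ?thesis
    by (simp add: I_def sum_subtractf right_diff_distrib)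
qed

end

text \<open>Replacing \<open>f\<close> by a step function with jumps in \<open>D\<close> costs at
  most the mass times the uniform distance, for all \<open>n\<close> alike, and for step functions
  only finitely many interval masses matter. The result serves twice: to identify limits found by
  Helly's theorem and to pass from increments back to loose convergence.\<close>

lemma I_tendsto:
  fixes D :: "real set"
  assumes pair: "\<And>n::nat. finite_borel_pair (P n) (N n)" and limit: "finite_borel_pair P' N'"
    and mass: "\<And>n. finite_borel_pair.mass (P n) (N n) \<le> C"
    and dense: "\<And>a b. a < b \<Longrightarrow> \<exists>x\<in>D. a < x \<and> x < b"
    and conv: "\<And>a b. a \<in> D \<Longrightarrow> b \<in> D \<Longrightarrow> a < b \<Longrightarrow>
      (\<lambda>n. measure (P n) {a<..b} - measure (N n) {a<..b})
        \<longlonglongrightarrow> measure P' {a<..b} - measure N' {a<..b}"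
    and f: "vanishing f"
  shows "(\<lambda>n. finite_borel_pair.I (P n) (N n) f) \<longlonglongrightarrow> finite_borel_pair.I P' N' f"
proof (rule LIMSEQ_I)
  interpret n: finite_borel_pair "P n" "N n" for n by (rule pair)
  interpret lim: finite_borel_pair P' N' by (rule limit)
  fix \<epsilon> :: real assume "0 < \<epsilon>"
  \<comment> \<open>The summand \<open>1\<close> makes \<open>K\<close> positive and the total
    approximation error \<open>C * \<eta> + lim.mass * \<eta>\<close> strictly less than
    \<open>\<epsilon> / 2\<close>; the other half is spent on the step function.\<close>
  define K where "K = C + lim.mass + 1"
  have "0 \<le> C"
    using n.mass_nonneg[of undefined] mass[of undefined] by linarith
  then have K: "0 < K"
    using lim.mass_nonneg by (simp add: K_def)
  define \<eta> where "\<eta> = \<epsilon> / (2 * K)"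
  have \<eta>: "0 < \<eta>" "K * \<eta> = \<epsilon> / 2"
    using \<open>0 < \<epsilon>\<close> K by (simp_all add: \<eta>_def field_simps)
  obtain x :: "nat \<Rightarrow> real" and m where x: "strict_mono x" "range x \<subseteq> D"
    and approx: "\<And>t. \<bar>f t - (\<Sum>i<m. f (x (Suc i)) * indicator {x i<..x (Suc i)} t)\<bar> \<le> \<eta>"
    using vanishing_step_approximation[OF f \<eta>(1) dense] by metis
  define s where "s t = (\<Sum>i<m. f (x (Suc i)) * indicator {x i<..x (Suc i)} t)" for t
  have s_eq: "s = (\<lambda>t. \<Sum>i<m. f (x (Suc i)) * indicator {x i<..x (Suc i)} t)"
    by (simp add: s_def fun_eq_iff)
  have f_borel: "f \<in> borel_measurable borel"
    using f by (rule vanishing_borel)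
  have s_borel: "s \<in> borel_measurable borel"
    unfolding s_eq by measurable
  obtain c where c: "\<And>x. \<bar>f x\<bar> \<le> c"
    using vanishing_bounded[OF f] by blast
  have s_bound: "\<bar>s t\<bar> \<le> c + \<eta>" for t
    using approx[of t] c[of t] unfolding s_def by linarith
  have close: "\<bar>finite_borel_pair.I P N f - finite_borel_pair.I P N s\<bar>
      \<le> finite_borel_pair.mass P N * \<eta>" if "finite_borel_pair P N" for P N
  proof -
    interpret finite_borel_pair P N by (rule that)
    show ?thesis
      using I_bound[of "\<lambda>t. f t - s t" \<eta>, OF borel_measurable_diff[OF f_borel s_borel]
          approx[folded s_def]]
        I_diff[of f s] integrable_bounded[OF f_borel c] integrable_bounded[OF s_borel s_bound]
      by simp
  qed
  have "(\<lambda>n. n.I n s) \<longlonglongrightarrow> lim.I s"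
    unfolding s_eq n.I_step lim.I_step
    using x by (intro tendsto_sum tendsto_mult tendsto_const conv) (auto simp: strict_mono_Suc_iff)
  then obtain n0 where n0: "\<And>n. n0 \<le> n \<Longrightarrow> \<bar>n.I n s - lim.I s\<bar> < \<epsilon> / 2"
    using LIMSEQ_D[of "\<lambda>n. n.I n s" "lim.I s" "\<epsilon> / 2"] \<open>0 < \<epsilon>\<close> by auto
  have "\<bar>n.I n f - lim.I f\<bar> < \<epsilon>" if "n0 \<le> n" for n
  proof -
    have "n.mass n * \<eta> \<le> C * \<eta>"
      using mass \<eta>(1) by (simp add: mult_right_mono)
    moreover have "C * \<eta> + lim.mass * \<eta> < \<epsilon> / 2"
      using \<eta> by (simp add: K_def algebra_simps)
    ultimately show ?thesis
      using close[OF pair, of n] close[OF limit] n0[OF that] by linarith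
  qed
  then show "\<exists>n0. \<forall>n\<ge>n0. norm (n.I n f - lim.I f) < \<epsilon>"
    by auto
qed

subsection \<open>Uniform boundedness\<close>

lemma inner_regular_compact:
  fixes M :: "real measure"
  assumes "finite_measure M" "sets M = sets borel" "B \<in> sets borel" "0 < \<epsilon>"
  obtains K where "compact K" "K \<subseteq> B" "measure M B - \<epsilon> < measure M K"
\<comment> \<open>If \<open>B\<close> has measure zero,
  \<open>ennreal (measure M B - \<epsilon>)\<close> is \<open>0\<close> too, and no strict
  inequality is available for drawing a compact set from the supremum; the empty set serves
  instead.\<close>
proof (cases "measure M B = 0")
  case True
  with assms(4) show thesis
    by (intro that[of "{}"]) auto
next
  case False
  interpret finite_measure M by fact
  have "ennreal (measure M B - \<epsilon>) < emeasure M B"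
    using False assms(4) by (simp add: emeasure_eq_measure ennreal_less_iff zero_less_measure_iff ennreal_lessI)
  also have "emeasure M B = (SUP K \<in> {K. K \<subseteq> B \<and> compact K}. emeasure M K)"
    using assms by (intro inner_regular) auto
  finally obtain K where "K \<subseteq> B" "compact K" "ennreal (measure M B - \<epsilon>) < ennreal (measure M K)"
    unfolding less_SUP_iff emeasure_eq_measure by auto
  then show thesis
    by (meson ennreal_leI not_le that)
qed

text \<open>A Urysohn function \<open>u\<close> for \<open>K\<close> and \<open>L\<close> need not
  vanish at infinity. It is multiplied by a second one, \<open>w\<close>, which is \<open>1\<close>
  on \<open>K \<union> L\<close> and \<open>0\<close> outside a bounded set.\<close>

lemma vanishing_separation:
  assumes "compact K" "compact L" "K \<inter> L = {}"
  obtains g :: "real \<Rightarrow> real" where "vanishing g" "\<And>x. \<bar>g x\<bar> \<le> 1"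
    "\<And>x. x \<in> K \<Longrightarrow> g x = 1" "\<And>x. x \<in> L \<Longrightarrow> g x = -1"
proof -
  obtain u :: "real \<Rightarrow> real" where u: "continuous_on UNIV u" "\<And>x. u x \<in> closed_segment 1 (-1)"
      "\<And>x. x \<in> K \<Longrightarrow> u x = 1" "\<And>x. x \<in> L \<Longrightarrow> u x = -1"
    using Urysohn[of K L] assms compact_imp_closed by metis
  obtain R where R: "\<And>x. x \<in> K \<union> L \<Longrightarrow> norm x < R"
    using compact_imp_bounded[OF compact_Un[OF assms(1,2)]] unfolding bounded_pos_less by blast
  have "closed {x :: real. R \<le> norm x}"
    by (intro closed_Collect_le continuous_intros)
  moreover have "(K \<union> L) \<inter> {x. R \<le> norm x} = {}"
    using R by force
  ultimately obtain w :: "real \<Rightarrow> real" where w: "continuous_on UNIV w" "\<And>x. w x \<in> closed_segment 1 0"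
      "\<And>x. x \<in> K \<union> L \<Longrightarrow> w x = 1" "\<And>x. x \<in> {x. R \<le> norm x} \<Longrightarrow> w x = 0"
    using Urysohn[of "K \<union> L" "{x. R \<le> norm x}"] compact_imp_closed[OF compact_Un[OF assms(1,2)]] by metis
  show thesis
  proof (rule that[of "\<lambda>x. u x * w x"])
    show "vanishing (\<lambda>x. u x * w x)"
      using u(1) w(1,4) by (intro vanishing_compact_support[of _ R] continuous_intros) auto
    show "\<bar>u x * w x\<bar> \<le> 1" for x
    proof -
      have "\<bar>u x\<bar> \<le> 1" "\<bar>w x\<bar> \<le> 1"
        using u(2)[of x] w(2)[of x] by (auto simp: closed_segment_eq_real_ivl)
      then show ?thesis
        by (simp add: abs_mult mult_le_one)
    qed
  qed (use u w in auto)
qed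

text \<open>The ideal test function is \<open>1\<close> on the approximate Hahn set \<open>B\<close>
  and \<open>-1\<close> off it; compact sets \<open>K\<close> and \<open>L\<close> carrying almost
  all the relevant mass admit a continuous substitute. Mass on which the substitute may have the
  wrong value is lost twice, so \<open>K\<close>, \<open>L\<close> and the defect of
  \<open>B\<close> cost \<open>2 * \<epsilon>\<close> each.\<close>

lemma (in finite_borel_pair) norming_function:
  assumes B: "B \<in> sets borel" "measure P (-B) + measure N B < \<epsilon>"
  obtains g where "vanishing g" "\<And>x. \<bar>g x\<bar> \<le> 1" "mass - 6 * \<epsilon> \<le> I g"
proof -
  have "0 < \<epsilon>"
    using B(2) measure_nonneg[of P "-B"] measure_nonneg[of N B] by linarith
  obtain K where K: "compact K" "K \<subseteq> B" "measure P B - \<epsilon> < measure P K"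
    using inner_regular_compact[OF P.finite_measure_axioms sets_P B(1) \<open>0 < \<epsilon>\<close>] .
  obtain L where L: "compact L" "L \<subseteq> -B" "measure N (-B) - \<epsilon> < measure N L"
    using inner_regular_compact[OF N.finite_measure_axioms sets_N borel_comp[OF B(1)] \<open>0 < \<epsilon>\<close>] .
  have "K \<inter> L = {}"
    using K(2) L(2) by auto
  with K(1) L(1) obtain g :: "real \<Rightarrow> real" where g: "vanishing g" "\<And>x. \<bar>g x\<bar> \<le> 1"
      "\<And>x. x \<in> K \<Longrightarrow> g x = 1" "\<And>x. x \<in> L \<Longrightarrow> g x = -1"
    using vanishing_separation by metis
  have [measurable]: "K \<in> sets borel" "L \<in> sets borel"
    using K(1) L(1) by (auto intro: borel_compact)
  have compl: "measure P (-B) = measure P UNIV - measure P B"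
      "measure N (-B) = measure N UNIV - measure N B"
    using P.finite_measure_compl[of B] N.finite_measure_compl[of B] B(1)
    by (simp_all add: Compl_eq_Diff_UNIV)
  have "(\<integral>x. 2 * indicator K x - 1 \<partial>P) \<le> (\<integral>x. g x \<partial>P)"
  proof (intro integral_mono integrable_vanishing[OF g(1)])
    show "2 * indicator K x - 1 \<le> g x" for x
      using g(2)[of x] g(3)[of x] by (cases "x \<in> K") auto
  qed (simp add: P.emeasure_eq_measure)
  then have "2 * measure P K - measure P UNIV \<le> (\<integral>x. g x \<partial>P)"
    by (simp add: P.emeasure_eq_measure)
  moreover have "(\<integral>x. g x \<partial>N) \<le> (\<integral>x. 1 - 2 * indicator L x \<partial>N)"
  proof (intro integral_mono integrable_vanishing[OF g(1)])
    show "g x \<le> 1 - 2 * indicator L x" for x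
      using g(2)[of x] g(4)[of x] by (cases "x \<in> L") auto
  qed (simp add: N.emeasure_eq_measure)
  then have "(\<integral>x. g x \<partial>N) \<le> measure N UNIV - 2 * measure N L"
    by (simp add: N.emeasure_eq_measure)
  ultimately have "mass - 6 * \<epsilon> \<le> I g"
    using K(3) L(3) B(2) compl unfolding I_def mass_def by linarith
  with g(1,2) show thesis
    by (rule that)
qed

text \<open>
  Gliding hump: \<open>Z\<close> is the limit of partial sums whose \<open>k\<close>-th term is \<open>\<plusminus>3\<^sup>-\<^sup>k\<close> times a norming function
  of the \<open>\<nu> k\<close>-th functional. The sign is chosen so that this functional is large on the \<open>k\<close>-th
  partial sum, and the remaining terms are too small to destroy this.
\<close>

lemma mass_bounded_if_I_bounded:
  fixes P N :: "nat \<Rightarrow> real measure"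
  assumes pair: "\<And>n. finite_borel_pair (P n) (N n)"
    and norming: "\<And>n. \<exists>g. vanishing g \<and> (\<forall>x. \<bar>g x\<bar> \<le> 1) \<and>
      3 / 4 * finite_borel_pair.mass (P n) (N n) \<le> finite_borel_pair.I (P n) (N n) g"
    and bounded: "\<And>f. vanishing f \<Longrightarrow> \<exists>c. \<forall>n. \<bar>finite_borel_pair.I (P n) (N n) f\<bar> \<le> c"
  shows "\<exists>C. \<forall>n. finite_borel_pair.mass (P n) (N n) \<le> C"
proof (rule ccontr)
  interpret n: finite_borel_pair "P n" "N n" for n by (rule pair)
  assume "\<nexists>C. \<forall>n. n.mass n \<le> C"
  \<comment> \<open>Masses beyond \<open>4 ^ k\<close> outgrow the weights
    \<open>(1 / 3) ^ k\<close>: the products exceed \<open>(4 / 3) ^ k\<close>.\<close>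
  then have "\<forall>k. \<exists>n. 4 ^ k < n.mass n"
    by (meson not_le)
  then obtain \<nu> where \<nu>: "\<And>k. 4 ^ k < n.mass (\<nu> k)"
    by metis
  from norming obtain g where g: "\<And>n. vanishing (g n)" "\<And>n x. \<bar>g n x\<bar> \<le> 1"
      "\<And>n. 3 / 4 * n.mass n \<le> n.I n (g n)"
    by metis
  define q :: "nat \<Rightarrow> real" where "q k = (1 / 3) ^ k" for k
  have q: "0 < q k" "q (Suc k) = q k / 3" for k
    by (simp_all add: q_def)
  have "\<exists>Y. vanishing Y \<and> (\<forall>x. \<bar>Y x - X x\<bar> \<le> q k) \<and> 3 / 4 * q k * n.mass (\<nu> k) \<le> \<bar>n.I (\<nu> k) Y\<bar>"
    if X: "vanishing X" for X k
  proof -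
    define Y where "Y c = (\<lambda>x. X x + c * g (\<nu> k) x)" for c
    have I: "n.I (\<nu> k) (Y c) = n.I (\<nu> k) X + c * n.I (\<nu> k) (g (\<nu> k))" for c
      unfolding Y_def using n.integrable_vanishing[OF X] n.integrable_vanishing[OF g(1)]
      by (intro n.I_add_mult)
    have "q k * (3 / 4 * n.mass (\<nu> k)) \<le> q k * n.I (\<nu> k) (g (\<nu> k))"
      using g(3) q(1) by (intro mult_left_mono) (auto intro: less_imp_le)
    \<comment> \<open>For reals \<open>a\<close> and \<open>b\<close>, at least one of
      \<open>\<bar>a + b\<bar>\<close> and \<open>\<bar>a - b\<bar>\<close> is no smaller than
      \<open>b\<close>; this decides the sign of the new term.\<close>
    then have "3 / 4 * q k * n.mass (\<nu> k) \<le> \<bar>n.I (\<nu> k) (Y (q k))\<bar> \<or>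
        3 / 4 * q k * n.mass (\<nu> k) \<le> \<bar>n.I (\<nu> k) (Y (- q k))\<bar>"
      unfolding I by (simp only: mult.assoc mult.left_commute[of "q k"] mult_minus_left) linarith
    then obtain c where c: "\<bar>c\<bar> = \<bar>q k\<bar>" "3 / 4 * q k * n.mass (\<nu> k) \<le> \<bar>n.I (\<nu> k) (Y c)\<bar>"
      using abs_minus_cancel by blast
    have "\<bar>Y c x - X x\<bar> \<le> q k" for x
      using mult_left_mono[OF g(2)[of "\<nu> k" x], of "q k"] q(1)[of k] c(1)
      by (simp add: abs_mult Y_def)
    moreover have "vanishing (Y c)"
      unfolding Y_def using X g(1) by (rule vanishing_add_mult)
    ultimately show ?thesis
      using c(2) by blast
  qed
  then obtain X where "\<forall>k. vanishing (X k) \<and>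
      (\<forall>x. \<bar>X (Suc k) x - X k x\<bar> \<le> q k) \<and> 3 / 4 * q k * n.mass (\<nu> k) \<le> \<bar>n.I (\<nu> k) (X (Suc k))\<bar>"
    using dependent_nat_choice[of "\<lambda>_ X. vanishing X" "\<lambda>k X Y. (\<forall>x. \<bar>Y x - X x\<bar> \<le> q k) \<and>
        3 / 4 * q k * n.mass (\<nu> k) \<le> \<bar>n.I (\<nu> k) Y\<bar>"] vanishing_zero by blast
  then have X: "\<And>k. vanishing (X k)" "\<And>k x. \<bar>X (Suc k) x - X k x\<bar> \<le> q k"
      "\<And>k. 3 / 4 * q k * n.mass (\<nu> k) \<le> \<bar>n.I (\<nu> k) (X (Suc k))\<bar>"
    by blast+
  \<comment> \<open>The right-hand side is the exact sum of \<open>q\<close> from \<open>k\<close>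
    up to, but excluding, \<open>k + m\<close>. Keeping the subtracted term lets the induction
    close; dropping it leaves the tail bound \<open>3 / 2 * q k\<close>.\<close>
  have telescope: "\<bar>X (k + m) x - X k x\<bar> \<le> 3 / 2 * (q k - q (k + m))" for k m x
  proof (induction m)
    case (Suc m)
    have "\<bar>X (Suc (k + m)) x - X k x\<bar> \<le> \<bar>X (Suc (k + m)) x - X (k + m) x\<bar> + \<bar>X (k + m) x - X k x\<bar>"
      by simp
    also have "\<dots> \<le> q (k + m) + 3 / 2 * (q k - q (k + m))"
      using Suc X(2) by (intro add_mono)
    also have "\<dots> = 3 / 2 * (q k - q (Suc (k + m)))"
      by (simp add: q(2) field_simps)
    finally show ?case
      by simp
  qed simp
  have X_le: "\<bar>X m x - X k x\<bar> \<le> 3 / 2 * q k" if "k \<le> m" for k m x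
  proof -
    obtain d where "m = k + d"
      using le_Suc_ex[OF \<open>k \<le> m\<close>] by blast
    moreover have "0 < q (k + d)"
      by (rule q(1))
    ultimately show ?thesis
      using telescope[of k d x] by simp
  qed
  have "q \<longlonglongrightarrow> 0"
    unfolding q_def by (rule LIMSEQ_realpow_zero) auto
  have "uniformly_Cauchy_on UNIV X"
  proof (rule uniformly_Cauchy_onI')
    fix \<epsilon> :: real assume "0 < \<epsilon>"
    then obtain M where M: "q M < \<epsilon> / 3"
      using eventually_happens'[OF sequentially_bot order_tendstoD(2)[OF \<open>q \<longlonglongrightarrow> 0\<close>]]
      by (metis zero_less_divide_iff zero_less_numeral)
    show "\<exists>M. \<forall>x\<in>UNIV. \<forall>m\<ge>M. \<forall>n>m. dist (X m x) (X n x) < \<epsilon>"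
    proof (intro exI ballI allI impI)
      fix x m n assume "M \<le> m" "m < n"
      then show "dist (X m x) (X n x) < \<epsilon>"
        using X_le[of M m x] X_le[of M n x] M unfolding dist_real_def by linarith
    qed
  qed
  then obtain Z where Z: "uniform_limit UNIV X Z sequentially"
    using Cauchy_uniformly_convergent uniformly_convergent_on_def by blast
  have vZ: "vanishing Z"
    using X(1) Z by (rule vanishing_uniform_limit)
  have Z_le: "\<bar>Z x - X k x\<bar> \<le> 3 / 2 * q k" for k x
  proof (rule LIMSEQ_le_const2)
    show "(\<lambda>m. \<bar>X m x - X k x\<bar>) \<longlonglongrightarrow> \<bar>Z x - X k x\<bar>"
      using tendsto_uniform_limitI[OF Z UNIV_I] by (intro tendsto_intros)
    show "\<exists>M. \<forall>m\<ge>M. \<bar>X m x - X k x\<bar> \<le> 3 / 2 * q k"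
      using X_le by blast
  qed
  obtain c where c: "\<And>n. \<bar>n.I n Z\<bar> \<le> c"
    using bounded[OF vZ] by blast
  \<comment> \<open>The terms after the \<open>k\<close>-th change the functional by at most
    \<open>3 / 2 * q (Suc k)\<close> times the mass, that is, half of \<open>q k\<close> times the
    mass. Of the guaranteed three quarters one quarter remains, whence the factor
    \<open>4\<close>.\<close>
  have "(4 / 3) ^ k \<le> 4 * c" for k
  proof -
    have "\<bar>n.I (\<nu> k) (\<lambda>x. Z x - X (Suc k) x)\<bar> \<le> n.mass (\<nu> k) * (3 / 2 * q (Suc k))"
      using Z_le vZ X(1) by (intro n.I_bound borel_measurable_diff vanishing_borel)
    also have "n.I (\<nu> k) (\<lambda>x. Z x - X (Suc k) x) = n.I (\<nu> k) Z - n.I (\<nu> k) (X (Suc k))"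
      by (intro n.I_diff n.integrable_vanishing vZ X(1))
    finally have "\<bar>n.I (\<nu> k) Z - n.I (\<nu> k) (X (Suc k))\<bar> \<le> 1 / 2 * (q k * n.mass (\<nu> k))"
      by (simp add: q(2) mult.commute)
    moreover have "3 / 4 * (q k * n.mass (\<nu> k)) \<le> \<bar>n.I (\<nu> k) (X (Suc k))\<bar>"
      using X(3)[of k] by (simp add: mult.assoc)
    moreover have "q k * 4 ^ k \<le> q k * n.mass (\<nu> k)"
      using \<nu>[of k] q(1)[of k] by simp
    moreover have "q k * 4 ^ k = (4 / 3) ^ k"
      by (simp add: q_def power_divide)
    ultimately show ?thesis
      using c[of "\<nu> k"] by linarith
  qed
  then show False
    using real_arch_pow[of "4 / 3" "4 * c"] by (force simp: not_le[symmetric])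
qed

subsection \<open>Convergent subsequences\<close>

text \<open>The limit measure is the Stieltjes measure of the Helly limit \<open>G\<close> of the
  distribution functions, and \<open>S\<close> is the set of discontinuities of \<open>G\<close>.
  Since mass may escape to infinity, \<open>G\<close> need not be the distribution function of that
  measure, so only masses of bounded intervals are compared.\<close>

lemma Helly_measures:
  fixes M :: "nat \<Rightarrow> real measure"
  assumes fin: "\<And>n. finite_measure (M n)" and sets: "\<And>n. sets (M n) = sets borel"
    and mass: "\<And>n. measure (M n) UNIV \<le> C"
  obtains s M' S where "strict_mono (s :: nat \<Rightarrow> nat)" "finite_measure M'" "sets M' = sets borel"
    "countable S" "\<And>a b. a \<notin> S \<Longrightarrow> b \<notin> S \<Longrightarrow> a < b \<Longrightarrow>
      (\<lambda>n. measure (M (s n)) {a<..b}) \<longlonglongrightarrow> measure M' {a<..b}"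
proof -
  have fbm: "finite_borel_measure (M n)" for n
    using fin sets by (simp add: finite_borel_measure_def finite_borel_measure_axioms_def)
  interpret finite_borel_measure "M n" for n by (rule fbm)
  have "\<bar>cdf (M n) x\<bar> \<le> C" for n x
    using cdf_nonneg[of n x] cdf_bounded[of n x] mass[of n] by (simp add: borel_UNIV)
  then obtain s G where s: "strict_mono (s :: nat \<Rightarrow> nat)"
    and G: "\<And>x. continuous (at_right x) G" "mono G" "\<And>x. \<bar>G x\<bar> \<le> C"
    and conv: "\<And>x. continuous (at x) G \<Longrightarrow> (\<lambda>n. cdf (M (s n)) x) \<longlonglongrightarrow> G x"
    using Helly_selection[of "\<lambda>n. cdf (M n)" C] cdf_is_right_cont cdf_nondecreasing
    unfolding mono_def by metis
  define M' where "M' = interval_measure G"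
  have Ioc: "emeasure M' {a<..b} = ennreal (G b - G a)" if "a \<le> b" for a b
    unfolding M'_def using that G by (intro emeasure_interval_measure_Ioc) (auto dest: monoD)
  have M': "sets M' = sets borel" "space M' = UNIV"
    by (simp_all add: M'_def)
  have "finite_measure M'"
  proof
    have "emeasure M' (space M') = (SUP n. emeasure M' {- real n<..real n})"
      unfolding M'(2) UN_Ioc_eq_UNIV[symmetric]
      by (intro SUP_emeasure_incseq[symmetric]) (auto simp: M' incseq_def)
    also have "\<dots> \<le> ennreal (2 * C)"
    proof (rule SUP_least)
      fix n
      have "G (real n) - G (- real n) \<le> 2 * C"
        using G(3)[of "real n"] G(3)[of "- real n"] by linarith
      then show "emeasure M' {- real n<..real n} \<le> ennreal (2 * C)"
        by (simp add: Ioc ennreal_leI)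
    qed
    finally show "emeasure M' (space M') \<noteq> \<infinity>"
      by (auto simp: top_unique)
  qed
  moreover have "(\<lambda>n. measure (M (s n)) {a<..b}) \<longlonglongrightarrow> measure M' {a<..b}"
    if "a \<notin> {x. \<not> isCont G x}" "b \<notin> {x. \<not> isCont G x}" "a < b" for a b
  proof -
    have "measure M' {a<..b} = G b - G a"
      using Ioc[of a b] \<open>a < b\<close> G(2) by (simp add: measure_def monoD)
    moreover have "measure (M (s n)) {a<..b} = cdf (M (s n)) b - cdf (M (s n)) a" for n
      using \<open>a < b\<close> by (rule cdf_diff_eq[symmetric])
    ultimately show ?thesis
      using that(1,2) by (auto intro!: tendsto_diff conv)
  qed
  ultimately show thesis
    using s M'(1) mono_ctble_discont[OF G(2)] by (rule_tac that) assumption+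
qed

text \<open>The second extraction runs along the first subsequence, so both convergences survive,
  off the union of the two countable sets.\<close>

lemma Helly_pairs:
  fixes P N :: "nat \<Rightarrow> real measure"
  assumes pair: "\<And>n. finite_borel_pair (P n) (N n)"
    and mass: "\<And>n. finite_borel_pair.mass (P n) (N n) \<le> C"
  obtains s P' N' S where "strict_mono (s :: nat \<Rightarrow> nat)" "finite_borel_pair P' N'" "countable S"
    "\<And>a b. a \<notin> S \<Longrightarrow> b \<notin> S \<Longrightarrow> a < b \<Longrightarrow>
      (\<lambda>n. measure (P (s n)) {a<..b} - measure (N (s n)) {a<..b})
        \<longlonglongrightarrow> measure P' {a<..b} - measure N' {a<..b}"
proof -
  interpret finite_borel_pair "P n" "N n" for n by (rule pair)
  have le: "measure (P n) UNIV \<le> C" "measure (N n) UNIV \<le> C" for n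
    using mass[of n] measure_nonneg[of "P n" UNIV] measure_nonneg[of "N n" UNIV]
    unfolding mass_def by linarith+
  obtain s1 P' S1 where 1: "strict_mono (s1 :: nat \<Rightarrow> nat)" "finite_measure P'" "sets P' = sets borel"
      "countable S1" "\<And>a b. a \<notin> S1 \<Longrightarrow> b \<notin> S1 \<Longrightarrow> a < b \<Longrightarrow>
        (\<lambda>n. measure (P (s1 n)) {a<..b}) \<longlonglongrightarrow> measure P' {a<..b}"
    using Helly_measures[of P C, OF P.finite_measure_axioms sets_P le(1)] by metis
  obtain s2 N' S2 where 2: "strict_mono (s2 :: nat \<Rightarrow> nat)" "finite_measure N'" "sets N' = sets borel"
      "countable S2" "\<And>a b. a \<notin> S2 \<Longrightarrow> b \<notin> S2 \<Longrightarrow> a < b \<Longrightarrow>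
        (\<lambda>n. measure (N (s1 (s2 n))) {a<..b}) \<longlonglongrightarrow> measure N' {a<..b}"
    using Helly_measures[of "\<lambda>n. N (s1 n)" C, OF N.finite_measure_axioms sets_N le(2)] by metis
  show thesis
  proof (rule that[of "s1 \<circ> s2" P' N' "S1 \<union> S2"])
    show "finite_borel_pair P' N'"
      using 1 2 by (simp add: finite_borel_pair_def finite_borel_pair_axioms_def)
    fix a b assume ab: "a \<notin> S1 \<union> S2" "b \<notin> S1 \<union> S2" "a < b"
    have "(\<lambda>n. measure (P (s1 (s2 n))) {a<..b}) \<longlonglongrightarrow> measure P' {a<..b}"
      using LIMSEQ_subseq_LIMSEQ[OF 1(5) 2(1), of a b] ab by (simp add: comp_def)
    then show "(\<lambda>n. measure (P ((s1 \<circ> s2) n)) {a<..b} - measure (N ((s1 \<circ> s2) n)) {a<..b})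
        \<longlonglongrightarrow> measure P' {a<..b} - measure N' {a<..b}"
      using 2(5)[of a b] ab by (auto intro!: tendsto_diff)
  qed (use 1 2 in \<open>auto intro: strict_mono_o\<close>)
qed

text \<open>A continuous approximation of \<open>indicator {c<..}\<close> from below that rises with
  slope \<open>k + 1\<close>. It is \<open>0\<close> at \<open>c\<close> itself, so the trapezoid
  \<open>ramp k a x - ramp k b x\<close> tends to the indicator of the half-open
  \<open>{a<..b}\<close>, endpoints included.\<close>

definition ramp :: "nat \<Rightarrow> real \<Rightarrow> real \<Rightarrow> real" where
  "ramp k c x = max 0 (min 1 (real (Suc k) * (x - c)))"

lemma ramp_0: "x \<le> c \<Longrightarrow> ramp k c x = 0"
  using mult_nonneg_nonpos[of "real (Suc k)" "x - c"] by (simp add: ramp_def)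

lemma ramp_1:
  assumes "c + 1 \<le> x"
  shows "ramp k c x = 1"
proof -
  have "1 * 1 \<le> real (Suc k) * (x - c)"
    using assms by (intro mult_mono) auto
  then show ?thesis
    by (simp add: ramp_def)
qed

lemma ramp_bounds: "0 \<le> ramp k c x" "ramp k c x \<le> 1"
  by (simp_all add: ramp_def)

lemma ramp_tendsto: "(\<lambda>k. ramp k c x) \<longlonglongrightarrow> indicator {c<..} x"
proof (cases "c < x")
  case True
  obtain k0 where k0: "1 / (x - c) < real k0"
    using reals_Archimedean2 by blast
  have "ramp k c x = 1" if "k0 \<le> k" for k
  proof -
    have "1 / (x - c) \<le> real (Suc k)"
      using k0 that by simp
    then have "1 \<le> real (Suc k) * (x - c)"
      using True by (simp add: field_simps)
    then show ?thesis
      by (simp add: ramp_def)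
  qed
  then have "\<forall>\<^sub>F k in sequentially. ramp k c x = 1"
    by (auto simp: eventually_sequentially)
  then show ?thesis
    using True by (simp add: tendsto_eventually)
qed (simp add: ramp_0)

lemma vanishing_ramp_diff:
  assumes "a < b"
  shows "vanishing (\<lambda>x. ramp k a x - ramp k b x)"
proof (rule vanishing_compact_support[where R = "\<bar>a\<bar> + \<bar>b\<bar> + 1"])
  show "continuous_on UNIV (\<lambda>x. ramp k a x - ramp k b x)"
    unfolding ramp_def by (intro continuous_intros)
  fix x assume "\<bar>a\<bar> + \<bar>b\<bar> + 1 \<le> \<bar>x\<bar>"
  then consider "x \<le> a" | "b + 1 \<le> x"
    by linarith
  then show "ramp k a x - ramp k b x = 0"
    using assms by cases (simp_all add: ramp_0 ramp_1)
qed

text \<open>The trapezoids are bounded by \<open>1\<close>, so dominated convergence applies to both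
  finite measures; interval masses are thereby recovered from integrals of test functions.\<close>

lemma (in finite_borel_pair) I_ramp_diff_tendsto:
  assumes "a < b"
  shows "(\<lambda>k. I (\<lambda>x. ramp k a x - ramp k b x)) \<longlonglongrightarrow> measure P {a<..b} - measure N {a<..b}"
proof -
  have lim: "(\<lambda>k. ramp k a x - ramp k b x) \<longlonglongrightarrow> indicator {a<..b} x" for x
  proof -
    have "indicator {a<..} x - indicator {b<..} x = (indicator {a<..b} x :: real)"
      using assms by (auto simp: indicator_def)
    then show ?thesis
      using tendsto_diff[OF ramp_tendsto[of a x] ramp_tendsto[of b x]] by simp
  qed
  have borel: "(\<lambda>x. ramp k a x - ramp k b x) \<in> borel_measurable borel" for k
    using vanishing_ramp_diff[OF assms] by (rule vanishing_borel)
  have le: "\<bar>ramp k a x - ramp k b x\<bar> \<le> 1" for k x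
    using ramp_bounds[of k a x] ramp_bounds[of k b x] by linarith
  have "(\<lambda>k. \<integral>x. ramp k a x - ramp k b x \<partial>P) \<longlonglongrightarrow> (\<integral>x. indicator {a<..b} x \<partial>P)"
    using borel lim le by (intro integral_dominated_convergence[where w = "\<lambda>_. 1"]) auto
  moreover have "(\<lambda>k. \<integral>x. ramp k a x - ramp k b x \<partial>N) \<longlonglongrightarrow> (\<integral>x. indicator {a<..b} x \<partial>N)"
    using borel lim le by (intro integral_dominated_convergence[where w = "\<lambda>_. 1"]) auto
  ultimately show ?thesis
    unfolding I_def by (auto intro!: tendsto_diff)
qed

lemma measure_diff_eq_if_I_eq:
  assumes "finite_borel_pair P N" "finite_borel_pair P' N'"
    and "\<And>f. vanishing f \<Longrightarrow> finite_borel_pair.I P N f = finite_borel_pair.I P' N' f" and "a < b"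
  shows "measure P {a<..b} - measure N {a<..b} = measure P' {a<..b} - measure N' {a<..b}"
  using finite_borel_pair.I_ramp_diff_tendsto[OF assms(1,4)]
    finite_borel_pair.I_ramp_diff_tendsto[OF assms(2,4)]
  unfolding assms(3)[OF vanishing_ramp_diff[OF assms(4)]] by (rule LIMSEQ_unique)

text \<open>Helly's theorem provides some limit pair along a subsequence. Convergent increments
  imply convergent integrals, so that pair has the same functional as \<open>P'\<close> and
  \<open>N'\<close>, and therefore the same differences of interval masses.\<close>

lemma ex_convergent_subsequence:
  fixes P N :: "nat \<Rightarrow> real measure"
  assumes pair: "\<And>n. finite_borel_pair (P n) (N n)" and limit: "finite_borel_pair P' N'"
    and mass: "\<And>n. finite_borel_pair.mass (P n) (N n) \<le> C"
    and conv: "\<And>f. vanishing f \<Longrightarrow>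
      (\<lambda>n. finite_borel_pair.I (P n) (N n) f) \<longlonglongrightarrow> finite_borel_pair.I P' N' f"
  obtains s S where "strict_mono (s :: nat \<Rightarrow> nat)" "countable S"
    "\<And>a b. a \<notin> S \<Longrightarrow> b \<notin> S \<Longrightarrow> a < b \<Longrightarrow>
      (\<lambda>n. measure (P (s n)) {a<..b} - measure (N (s n)) {a<..b})
        \<longlonglongrightarrow> measure P' {a<..b} - measure N' {a<..b}"
proof -
  obtain s P'' N'' S where s: "strict_mono (s :: nat \<Rightarrow> nat)" "finite_borel_pair P'' N''" "countable S"
    and lim: "\<And>a b. a \<notin> S \<Longrightarrow> b \<notin> S \<Longrightarrow> a < b \<Longrightarrow>
      (\<lambda>n. measure (P (s n)) {a<..b} - measure (N (s n)) {a<..b})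
        \<longlonglongrightarrow> measure P'' {a<..b} - measure N'' {a<..b}"
    by (rule Helly_pairs[of P N C, OF pair mass]) blast
  have dense: "\<exists>x\<in>-S. a < x \<and> x < b" if "a < b" for a b
    using real_interval_avoid_countable_set[OF that s(3)] by auto
  have "finite_borel_pair.I P'' N'' f = finite_borel_pair.I P' N' f" if f: "vanishing f" for f
  proof (rule LIMSEQ_unique)
    show "(\<lambda>n. finite_borel_pair.I (P (s n)) (N (s n)) f) \<longlonglongrightarrow> finite_borel_pair.I P'' N'' f"
      using lim by (intro I_tendsto[OF pair s(2) mass dense _ f]) auto
    show "(\<lambda>n. finite_borel_pair.I (P (s n)) (N (s n)) f) \<longlonglongrightarrow> finite_borel_pair.I P' N' f"
      using LIMSEQ_subseq_LIMSEQ[OF conv[OF f] s(1)] by (simp add: comp_def)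
  qed
  from measure_diff_eq_if_I_eq[OF s(2) limit this] lim s(1,3) show thesis
    by (intro that[of s S]) auto
qed

subsection \<open>Signed measures on the real line\<close>

lemma LIMSEQ_if_subsequences:
  fixes X :: "nat \<Rightarrow> 'a::metric_space"
  assumes "\<And>r :: nat \<Rightarrow> nat. strict_mono r \<Longrightarrow> \<exists>s :: nat \<Rightarrow> nat. strict_mono s \<and> (\<lambda>n. X (r (s n))) \<longlonglongrightarrow> L"
  shows "X \<longlonglongrightarrow> L"
proof (rule ccontr)
  assume "\<not> X \<longlonglongrightarrow> L"
  then obtain \<epsilon> where \<epsilon>: "0 < \<epsilon>" "\<not> (\<forall>\<^sub>F n in cofinite. dist (X n) L < \<epsilon>)"
    by (auto simp: tendsto_iff cofinite_eq_sequentially)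
  then have "infinite {n. \<not> dist (X n) L < \<epsilon>}"
    by (simp add: eventually_cofinite)
  then obtain r :: "nat \<Rightarrow> nat" where r: "strict_mono r" "\<And>n. \<not> dist (X (r n)) L < \<epsilon>"
    using infinite_enumerate by blast
  obtain s :: "nat \<Rightarrow> nat" where "(\<lambda>n. X (r (s n))) \<longlonglongrightarrow> L"
    using assms[OF r(1)] by blast
  then have "\<forall>\<^sub>F n in sequentially. dist (X (r (s n))) L < \<epsilon>"
    using \<epsilon>(1) by (rule tendstoD)
  then show False
    using r(2) by simp
qed

locale real_signed_measure = signed_measure "borel :: real measure" \<mu> for \<mu>
begin

sublocale finite_borel_pair "jordan_pos borel \<mu>" "jordan_neg borel \<mu>"
  by unfold_locales simp_all

lemma I_eq: "I f = signed_integral borel \<mu> f"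
  by (simp add: I_def signed_integral_def)

lemma total_variation_eq: "total_variation borel \<mu> UNIV = ennreal mass"
  using total_variation_space unfolding mass_def by simp

lemma distribution_function_diff:
  assumes "a < b"
  shows "distribution_function \<mu> b - distribution_function \<mu> a =
    measure (jordan_pos borel \<mu>) {a<..b} - measure (jordan_neg borel \<mu>) {a<..b}"
proof -
  have "{..b} - {..a} = {a<..b}"
    using assms by auto
  then have "\<mu> {a<..b} = \<mu> {..b} - \<mu> {..a}"
    using Diff[of "{..b}" "{..a}"] assms by simp
  then show ?thesis
    using jordan_decomposition[of "{a<..b}"] by (simp add: distribution_function_def)
qed

end

lemma converges_basically_imp_almost_basically:
  assumes "converges_basically \<mu>s \<mu>"
  shows "converges_almost_basically \<mu>s \<mu>"
  unfolding converges_almost_basically_def fun_converges_almost_basically_def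
proof (intro allI impI)
  fix r :: "nat \<Rightarrow> nat" assume r: "strict_mono r"
  let ?conv = "\<lambda>s S. \<forall>x1\<in>- S. \<forall>x2\<in>- S.
    (\<lambda>l. distribution_function (\<mu>s (r (s l))) x1 - distribution_function (\<mu>s (r (s l))) x2)
      \<longlonglongrightarrow> distribution_function \<mu> x1 - distribution_function \<mu> x2"
  obtain s S where s: "strict_mono (s :: nat \<Rightarrow> nat)" "countable S" "?conv s S"
    using assms[unfolded converges_basically_def fun_converges_basically_def, THEN spec, THEN mp, OF r]
    by (elim exE conjE) (rule that)
  have "S \<in> null_sets lebesgue"
    by (intro null_sets_completionI countable_imp_null_set_lborel s(2))
  with s(1,3) show "\<exists>s S. strict_mono (s :: nat \<Rightarrow> nat) \<and> S \<in> null_sets lebesgue \<and> ?conv s S"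
    by (intro exI[of _ s] exI[of _ S] conjI)
qed

section \<open>Implications between the modes of convergence\<close>

context
  fixes \<mu>s :: "nat \<Rightarrow> real set \<Rightarrow> real" and \<mu> :: "real set \<Rightarrow> real"
  assumes \<mu>s: "\<And>n. finite_signed_measure borel (\<mu>s n)" and \<mu>: "finite_signed_measure borel \<mu>"
begin

interpretation n: real_signed_measure "\<mu>s n" for n
  by unfold_locales (rule \<mu>s)

interpretation lim: real_signed_measure \<mu>
  by unfold_locales (rule \<mu>)

lemma uniformly_bounded_iff: "uniformly_bounded_in_variation \<mu>s \<longleftrightarrow> (\<exists>C. \<forall>n. n.mass n \<le> C)"
proof
  assume "uniformly_bounded_in_variation \<mu>s"
  then have fin: "(SUP n. ennreal (n.mass n)) < \<infinity>"
    by (simp add: uniformly_bounded_in_variation_def n.total_variation_eq)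
  then obtain C where C: "(SUP n. ennreal (n.mass n)) = ennreal C" "0 \<le> C"
    by (cases "SUP n. ennreal (n.mass n)") auto
  have "ennreal (n.mass n) \<le> ennreal C" for n
    unfolding C(1)[symmetric] by (rule SUP_upper) simp
  then show "\<exists>C. \<forall>n. n.mass n \<le> C"
    using C(2) by auto
next
  assume "\<exists>C. \<forall>n. n.mass n \<le> C"
  then obtain C where C: "\<And>n. n.mass n \<le> C"
    by blast
  have "(SUP n. ennreal (n.mass n)) \<le> ennreal C"
    by (intro SUP_least ennreal_leI C)
  then show "uniformly_bounded_in_variation \<mu>s"
    by (auto simp: uniformly_bounded_in_variation_def n.total_variation_eq intro: le_less_trans)
qed

lemma converges_loosely_iff:
  "converges_loosely \<mu>s \<mu> \<longleftrightarrow> (\<forall>f. vanishing f \<longrightarrow>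
    (\<lambda>n. signed_integral borel (\<mu>s n) f) \<longlonglongrightarrow> signed_integral borel \<mu> f)"
  unfolding converges_loosely_def vanishing_def by blast

text \<open>A convergent sequence of integrals is bounded for each test function, so the gliding
  hump applies; norming functions come from approximate Hahn sets of the Jordan parts.\<close>

lemma loosely_imp_bounded:
  assumes "converges_loosely \<mu>s \<mu>"
  shows "\<exists>C. \<forall>n. n.mass n \<le> C"
proof (rule mass_bounded_if_I_bounded)
  show "\<exists>g. vanishing g \<and> (\<forall>x. \<bar>g x\<bar> \<le> 1) \<and> 3 / 4 * n.mass n \<le> n.I n g" for n
  proof (cases "n.mass n = 0")
    case True
    then show ?thesis
      by (intro exI[of _ "\<lambda>_. 0"]) (simp add: vanishing_zero n.I_def)
  next
    case False
    \<comment> \<open>A defect of \<open>n.mass n / 24\<close> costs six times as much in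
      \<open>norming_function\<close>, a quarter of the mass, which leaves the required
      \<open>3 / 4\<close>.\<close>
    then have "0 < n.mass n / 24"
      using n.mass_nonneg[of n] by simp
    then obtain B where "B \<in> sets borel"
        "measure (jordan_pos borel (\<mu>s n)) (- B) + measure (jordan_neg borel (\<mu>s n)) B < n.mass n / 24"
      using n.approx_Hahn[of "n.mass n / 24" n] unfolding Compl_eq_Diff_UNIV by (metis space_borel)
    then obtain g where "vanishing g" "\<And>x. \<bar>g x\<bar> \<le> 1" "n.mass n - 6 * (n.mass n / 24) \<le> n.I n g"
      using n.norming_function by metis
    then show ?thesis
      by (intro exI[of _ g]) auto
  qed
  show "\<exists>c. \<forall>n. \<bar>n.I n f\<bar> \<le> c" if "vanishing f" for f
  proof -
    have "Bseq (\<lambda>n. n.I n f)"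
      using assms that unfolding converges_loosely_iff n.I_eq
      by (intro convergent_imp_Bseq) (auto simp: convergent_def)
    then show ?thesis
      by (auto simp: Bseq_def)
  qed
qed (rule n.finite_borel_pair_axioms)

lemma loosely_imp_basically:
  assumes "converges_loosely \<mu>s \<mu>"
  shows "converges_basically \<mu>s \<mu>"
  unfolding converges_basically_def fun_converges_basically_def
proof (intro allI impI)
  fix r :: "nat \<Rightarrow> nat" assume r: "strict_mono r"
  obtain C where C: "\<And>n. n.mass n \<le> C"
    using loosely_imp_bounded[OF assms] by blast
  have "(\<lambda>n. n.I (r n) f) \<longlonglongrightarrow> lim.I f" if "vanishing f" for f
    using LIMSEQ_subseq_LIMSEQ[of "\<lambda>n. n.I n f" "lim.I f" r] assms that r
    unfolding converges_loosely_iff n.I_eq lim.I_eq by (simp add: comp_def)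
  from ex_convergent_subsequence[of "\<lambda>n. jordan_pos borel (\<mu>s (r n))" "\<lambda>n. jordan_neg borel (\<mu>s (r n))",
      OF n.finite_borel_pair_axioms lim.finite_borel_pair_axioms C this]
  obtain s S where s: "strict_mono (s :: nat \<Rightarrow> nat)" "countable S"
    and conv: "\<And>a b. a \<notin> S \<Longrightarrow> b \<notin> S \<Longrightarrow> a < b \<Longrightarrow>
      (\<lambda>n. measure (jordan_pos borel (\<mu>s (r (s n)))) {a<..b} - measure (jordan_neg borel (\<mu>s (r (s n)))) {a<..b})
        \<longlonglongrightarrow> measure (jordan_pos borel \<mu>) {a<..b} - measure (jordan_neg borel \<mu>) {a<..b}"
    by blast
  let ?F = "\<lambda>l. distribution_function (\<mu>s (r (s l)))"
  have less: "(\<lambda>l. ?F l b - ?F l a) \<longlonglongrightarrow> distribution_function \<mu> b - distribution_function \<mu> a"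
    if "a \<notin> S" "b \<notin> S" "a < b" for a b
    using conv[OF that] \<open>a < b\<close> by (simp add: n.distribution_function_diff lim.distribution_function_diff)
  \<comment> \<open>Increments are known only for ordered endpoints; the reverse order is a change
    of sign, and equal points give zero.\<close>
  have "(\<lambda>l. ?F l x1 - ?F l x2) \<longlonglongrightarrow> distribution_function \<mu> x1 - distribution_function \<mu> x2"
    if "x1 \<in> - S" "x2 \<in> - S" for x1 x2
  proof (rule linorder_cases[of x1 x2])
    assume "x1 < x2"
    then show ?thesis
      using tendsto_minus[OF less[of x1 x2]] that by simp
  qed (use less[of x2 x1] that in auto)
  with s show "\<exists>s S. strict_mono (s :: nat \<Rightarrow> nat) \<and> countable S \<and> (\<forall>x1\<in>- S. \<forall>x2\<in>- S.
      (\<lambda>l. distribution_function (\<mu>s (r (s l))) x1 - distribution_function (\<mu>s (r (s l))) x2)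
        \<longlonglongrightarrow> distribution_function \<mu> x1 - distribution_function \<mu> x2)"
    by (intro exI[of _ s] exI[of _ S] conjI) auto
qed

text \<open>By the subsequence principle it suffices to treat a subsequence whose increments
  converge off a null set; the bound on the masses then lets step functions with jumps outside that
  set approximate \<open>f\<close>.\<close>

lemma almost_basically_imp_loosely:
  assumes "converges_almost_basically \<mu>s \<mu>" and C: "\<And>n. n.mass n \<le> C"
  shows "converges_loosely \<mu>s \<mu>"
  unfolding converges_loosely_iff
proof (intro allI impI LIMSEQ_if_subsequences)
  fix f :: "real \<Rightarrow> real" and r :: "nat \<Rightarrow> nat"
  assume f: "vanishing f" and r: "strict_mono r"
  obtain s S where s: "strict_mono (s :: nat \<Rightarrow> nat)" "S \<in> null_sets lebesgue"
    and conv: "\<forall>x1\<in>- S. \<forall>x2\<in>- S.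
      (\<lambda>l. distribution_function (\<mu>s (r (s l))) x1 - distribution_function (\<mu>s (r (s l))) x2)
        \<longlonglongrightarrow> distribution_function \<mu> x1 - distribution_function \<mu> x2"
    using assms(1)[unfolded converges_almost_basically_def fun_converges_almost_basically_def,
        THEN spec, THEN mp, OF r]
    by (elim exE conjE) (rule that)
  \<comment> \<open>A Lebesgue null set contains no nonempty open interval, so its complement can
    supply the jump points.\<close>
  have dense: "\<exists>x\<in>-S. a < x \<and> x < b" if "a < b" for a b
  proof (rule ccontr)
    assume "\<not> ?thesis"
    then have "{a<..<b} \<subseteq> S"
      by auto
    then have "{a<..<b} \<in> null_sets lebesgue"
      by (intro null_sets_subset[OF s(2)]) auto
    with \<open>a < b\<close> show False
      by (simp add: null_sets_def)
  qed
  have "(\<lambda>l. n.I (r (s l)) f) \<longlonglongrightarrow> lim.I f"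
  proof (rule I_tendsto[OF n.finite_borel_pair_axioms lim.finite_borel_pair_axioms C dense _ f])
    fix a b assume ab: "a \<in> - S" "b \<in> - S" "a < b"
    show "(\<lambda>l. measure (jordan_pos borel (\<mu>s (r (s l)))) {a<..b} - measure (jordan_neg borel (\<mu>s (r (s l)))) {a<..b})
        \<longlonglongrightarrow> measure (jordan_pos borel \<mu>) {a<..b} - measure (jordan_neg borel \<mu>) {a<..b}"
      using conv[THEN bspec, OF ab(2), THEN bspec, OF ab(1)] ab(3)
      by (simp add: n.distribution_function_diff lim.distribution_function_diff)
  qed
  then show "\<exists>s. strict_mono s \<and>
      (\<lambda>n. signed_integral borel (\<mu>s (r (s n))) f) \<longlonglongrightarrow> signed_integral borel \<mu> f"
    using s(1) unfolding n.I_eq lim.I_eq by (intro exI[of _ s] conjI)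
qed

end

theorem corollary3p18:
  fixes \<mu>s :: "nat \<Rightarrow> real set \<Rightarrow> real" and \<mu> :: "real set \<Rightarrow> real"
  assumes "\<And>n. finite_signed_measure borel (\<mu>s n)"
    and "finite_signed_measure borel \<mu>"
  shows "(converges_loosely \<mu>s \<mu> \<longleftrightarrow>
            converges_basically \<mu>s \<mu> \<and> uniformly_bounded_in_variation \<mu>s) \<and>
         (converges_loosely \<mu>s \<mu> \<longleftrightarrow>
            converges_almost_basically \<mu>s \<mu> \<and> uniformly_bounded_in_variation \<mu>s)"
  \<comment> \<open>The implications form a cycle: loose convergence gives boundedness and basic
    convergence, basic gives almost basic, and almost basic with boundedness gives loose.\<close>
  using uniformly_bounded_iff[of \<mu>s \<mu>, OF assms] loosely_imp_bounded[of \<mu>s \<mu>, OF assms]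
    loosely_imp_basically[of \<mu>s \<mu>, OF assms] almost_basically_imp_loosely[of \<mu>s \<mu>, OF assms]
    converges_basically_imp_almost_basically[of \<mu>s \<mu>]
  by blast

end
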